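(* Let $\mathcal{C}_1\subseteq\mathcal{C}_2$ be idempotent equational classes of Boolean functions. Then the interval $[\mathcal{C}_1,\mathcal{C}_2]=\{\mathcal{K}\in{\bf E}_{\mathbb{B}}:\mathcal{C}_1\subseteq\mathcal{K}\subseteq\mathcal{C}_2\}$ contains uncountably many equational classes if and only if $\mathcal{C}_2\setminus\mathcal{C}_1$ contains a non-associative Boolean function.
   Context: $\mathbb{B}=\{0,1\}$; Boolean functions are maps $\mathbb{B}^n\to\mathbb{B}$, $n\ge1$. Composition $f(g_1,\dots,g_n)({\bf a})=f(g_1({\bf a}),\dots,g_n({\bf a}))$; class composition $\mathcal{I}\mathcal{J}=\{f(g_1,\dots,g_n): f\ n\text{-ary in }\mathcal{I},\ g_i\ m\text{-ary in }\mathcal{J}\}$; $\mathcal{C}$ is idempotent if $\mathcal{C}\mathcal{C}=\mathcal{C}$. For $m$-ary $g$ and $n$-ary $f$, $g\preceq_{\bf V}f$ means $g=f(p_1,\dots,p_n)$ for some $m$-ary projections $p_i$. An equational class is a set of Boolean functions closed downward under $\preceq_{\bf V}$; ${\bf E}_{\mathbb{B}}$ is the set of them. An $n$-ary $f$ is associative if for all $1\le i<j\le n$ and all $x_1,\dots,x_{2n-1}$: $f(x_1,\dots,x_{i-1},f(x_i,\dots,x_{i+n-1}),x_{i+n},\dots,x_{2n-1})=f(x_1,\dots,x_{j-1},f(x_j,\dots,x_{j+n-1}),x_{j+n},\dots,x_{2n-1})$. A function $g$ is quasi-associative if $g\preceq_{\bf V}f$ for some associative $f$, and non-associative if it is not quasi-associative.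 *)

theory Defs
  imports Main "HOL-Library.FuncSet" "HOL-Library.Countable_Set"
begin

definition vecs :: "nat \<Rightarrow> bool list set" where
  "vecs n = {a. length a = n}"

text \<open>A Boolean function is a pair of its arity and an extensional function, so that equality of
  pairs is equality of functions. The arity is needed as a component because a function that is
  constantly \<open>undefined\<close> is extensional for every arity.\<close>

type_synonym bfun = "nat \<times> (bool list \<Rightarrow> bool)"

definition bool_functions :: "bfun set" where
  "bool_functions = {(n, f). n \<ge> 1 \<and> f \<in> vecs n \<rightarrow>\<^sub>E UNIV}"

definition compose_fun :: "nat \<Rightarrow> (bool list \<Rightarrow> bool) \<Rightarrow> (bool list \<Rightarrow> bool) list \<Rightarrow> (bool list \<Rightarrow> bool)" where
  "compose_fun m f gs = (\<lambda>a\<in>vecs m. f (map (\<lambda>g. g a) gs))"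

definition class_comp :: "bfun set \<Rightarrow> bfun set \<Rightarrow> bfun set" where
  "class_comp I J =
     {(m, compose_fun m f gs) | m n f gs.
        (n, f) \<in> I \<and> length gs = n \<and> (\<forall>g\<in>set gs. (m, g) \<in> J)}"

definition idempotent_class :: "bfun set \<Rightarrow> bool" where
  "idempotent_class C \<longleftrightarrow> class_comp C C = C"

definition projections :: "nat \<Rightarrow> (bool list \<Rightarrow> bool) set" where
  "projections m = {(\<lambda>a\<in>vecs m. a ! i) | i. i < m}"

definition minor :: "bfun \<Rightarrow> bfun \<Rightarrow> bool"  (infix "\<preceq>\<^sub>V" 50) where
  "G \<preceq>\<^sub>V F \<longleftrightarrow>
     (\<exists>ps. length ps = fst F \<and> set ps \<subseteq> projections (fst G) \<and>
        snd G = compose_fun (fst G) (snd F) ps)"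

definition equational_class :: "bfun set \<Rightarrow> bool" where
  "equational_class C \<longleftrightarrow>
     C \<subseteq> bool_functions \<and> (\<forall>F\<in>C. \<forall>G\<in>bool_functions. G \<preceq>\<^sub>V F \<longrightarrow> G \<in> C)"

definition class_interval :: "bfun set \<Rightarrow> bfun set \<Rightarrow> bfun set set" where
  "class_interval C1 C2 = {K. equational_class K \<and> C1 \<subseteq> K \<and> K \<subseteq> C2}"

text \<open>Positions are counted from 0, so the inner block starts after the first \<open>i\<close> arguments.
  There is no pair \<open>i < j\<close> when \<open>n = 1\<close>: every unary function is associative.\<close>

definition inner_applied_at :: "nat \<Rightarrow> (bool list \<Rightarrow> bool) \<Rightarrow> nat \<Rightarrow> bool list \<Rightarrow> bool" where
  "inner_applied_at n f i xs = f (take i xs @ [f (take n (drop i xs))] @ drop (i + n) xs)"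

definition associative :: "bfun \<Rightarrow> bool" where
  "associative = (\<lambda>(n, f). \<forall>i j. i < j \<and> j < n \<longrightarrow>
     (\<forall>xs\<in>vecs (2 * n - 1). inner_applied_at n f i xs = inner_applied_at n f j xs))"

definition quasi_associative :: "bfun \<Rightarrow> bool" where
  "quasi_associative G \<longleftrightarrow> (\<exists>F\<in>bool_functions. associative F \<and> G \<preceq>\<^sub>V F)"

definition non_associative :: "bfun \<Rightarrow> bool" where
  "non_associative G \<longleftrightarrow> \<not> quasi_associative G"

end

theory Submission
  imports Defs
begin

text \<open>The quasi-associative functions are exactly the affine functions and the nonempty
  conjunctions and disjunctions of variables. Up to equivalence under minors they form six ascending
  chains, so if \<open>C2 - C1\<close> contains no other function, a class in the interval is determined by six
  downward closed sets of natural numbers.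

  Conversely, let \<open>g\<close> in \<open>C2 - C1\<close> be non-associative. It suffices to find an infinite antichain
  of functions generated by \<open>g\<close> that all have \<open>g\<close> as a minor: they lie in \<open>C2\<close> but not in \<open>C1\<close>, and
  each subset of the antichain gives a different class. The antichain consists of the functions
  \<open>G a (beta k y)\<close>, where \<open>beta k\<close> is a self-dual monotone threshold function of \<open>k + 1\<close> new
  variables \<open>y\<close> with weights \<open>k - 3, 1, \<dots>, 1\<close>, and where identifying all of \<open>y\<close> with one variable
  of \<open>a\<close> turns \<open>G\<close> into \<open>g\<close>. Depending on the values of \<open>g\<close> on constant tuples, \<open>g\<close> generates the
  majority operation or \<open>x \<and> (y \<or> z)\<close> or its dual, or one of \<open>x \<and> \<not> y\<close> and \<open>x + y\<close>, or the dual of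
  such a function; each of these is enough to build the functions \<open>G a (beta k y)\<close>.\<close>

section \<open>Boolean functions on infinite assignments\<close>

text \<open>Why the heavy variable of \<open>beta k\<close> has weight \<open>k - 3\<close>: the
  total weight \<open>2 * k - 3\<close> is odd and the threshold \<open>k - 1\<close> lies just
  above half of it, which gives self-duality. With heavy weight \<open>k - 1\<close> and threshold
  \<open>k\<close>, the heavy variable would need only one light partner, and identifying two light
  variables would give the next smaller function: a chain. Here it needs two partners, and merging
  two light variables creates a single sufficient partner, which no \<open>beta i\<close> with large
  \<open>i\<close> admits.

  Monotonicity and self-duality put \<open>beta k\<close> within reach of majority alone, and
  self-duality lets the same functions serve \<open>g\<close> and its dual. The obstacle is that
  \<open>g\<close> may generate neither \<open>beta k\<close> nor even a projection. Interpolation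
  is therefore carried out in an auxiliary set of functions \<open>r\<close> for which only a masked
  form is generated, such as \<open>a i \<and> r a\<close>, \<open>g a \<and> r a\<close> or
  \<open>r a \<noteq> a 0\<close>, and \<open>G\<close> is chosen so that the mask is
  harmless.\<close>

type_synonym bfn = "(nat \<Rightarrow> bool) \<Rightarrow> bool"

text \<open>On infinite assignments a minor is a substitution of indices, and the same term can be
  read at several arities; the arity survives only as this bound.\<close>

definition depends_below :: "nat \<Rightarrow> bfn \<Rightarrow> bool" where
  "depends_below n p \<longleftrightarrow> (\<forall>a b. (\<forall>i<n. a i = b i) \<longrightarrow> p a = p b)"

lemma depends_belowD: "depends_below n p \<Longrightarrow> (\<And>i. i < n \<Longrightarrow> a i = b i) \<Longrightarrow> p a = p b"
proof -
  assume "depends_below n p" and *: "\<And>i. i < n \<Longrightarrow> a i = b i"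
  from \<open>depends_below n p\<close> have "(\<forall>i<n. a i = b i) \<longrightarrow> p a = p b"
    unfolding depends_below_def by blast
  with * show "p a = p b" by simp
qed

definition emb :: "nat \<Rightarrow> bfn \<Rightarrow> bfun" where
  "emb n p = (n, \<lambda>v\<in>vecs n. p ((!) v))"

lemma fst_emb [simp]: "fst (emb n p) = n"
  by (simp add: emb_def)

lemma emb_in_bool_functions: "n \<ge> 1 \<Longrightarrow> emb n p \<in> bool_functions"
  by (auto simp: emb_def bool_functions_def)

lemma emb_list:
  assumes "length v = n"
  shows "snd (emb n p) v = p ((!) v)"
  using assms by (simp add: emb_def vecs_def)

lemma bool_functions_emb:
  assumes "F \<in> bool_functions"
  obtains n p where "n \<ge> 1" "depends_below n p" "F = emb n p"
proof -
  obtain n f where F: "F = (n, f)" "n \<ge> 1" "f \<in> vecs n \<rightarrow>\<^sub>E UNIV"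
    using assms by (auto simp: bool_functions_def)
  define p where "p = (\<lambda>a. f (map a [0..<n]))"
  have "depends_below n p"
    unfolding depends_below_def p_def by (auto intro!: arg_cong[where f = f])
  moreover have "f = (\<lambda>v\<in>vecs n. p ((!) v))"
  proof
    fix v
    show "f v = (\<lambda>v\<in>vecs n. p ((!) v)) v"
    proof (cases "v \<in> vecs n")
      case True
      then have "map ((!) v) [0..<n] = v" by (auto simp: vecs_def map_nth)
      with True show ?thesis by (simp add: p_def)
    next
      case False
      with F(3) show ?thesis by (auto simp: PiE_def extensional_def)
    qed
  qed
  ultimately have "depends_below n p" "F = emb n p" using F(1) by (simp_all only: emb_def)
  with that F(2) show ?thesis by blast
qed

lemma emb_minorD:
  assumes "depends_below m p" "depends_below n q" "emb m p \<preceq>\<^sub>V emb n q"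
  obtains \<sigma> where "\<And>i. i < n \<Longrightarrow> \<sigma> i < m" "p = (\<lambda>a. q (\<lambda>i. a (\<sigma> i)))"
proof -
  obtain ps where ps: "length ps = n" "set ps \<subseteq> projections m"
    "snd (emb m p) = compose_fun m (snd (emb n q)) ps"
    using assms(3) unfolding minor_def by auto
  have "\<forall>i<n. \<exists>j<m. ps ! i = (\<lambda>a\<in>vecs m. a ! j)"
    using ps(1,2) unfolding projections_def by (fastforce dest: nth_mem)
  then obtain \<sigma> where \<sigma>: "\<And>i. i < n \<Longrightarrow> \<sigma> i < m \<and> ps ! i = (\<lambda>a\<in>vecs m. a ! \<sigma> i)"
    by metis
  have "p a = q (\<lambda>i. a (\<sigma> i))" for a
  proof -
    let ?v = "map a [0..<m]"
    have v: "?v \<in> vecs m" by (simp add: vecs_def)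
    have "p a = p ((!) ?v)" by (rule depends_belowD[OF assms(1)]) simp
    also have "\<dots> = snd (emb m p) ?v" by (simp add: emb_list)
    also have "\<dots> = snd (emb n q) (map (\<lambda>g. g ?v) ps)"
      using v by (simp add: ps(3) compose_fun_def)
    also have "\<dots> = q ((!) (map (\<lambda>g. g ?v) ps))" using ps(1) by (simp add: emb_list)
    also have "\<dots> = q (\<lambda>i. a (\<sigma> i))"
      by (rule depends_belowD[OF assms(2)]) (use \<sigma> ps(1) v in simp)
    finally show ?thesis .
  qed
  then show ?thesis using that[of \<sigma>] \<sigma> by blast
qed

lemma emb_minorI:
  assumes "depends_below n q" "\<And>i. i < n \<Longrightarrow> \<sigma> i < m" "p = (\<lambda>a. q (\<lambda>i. a (\<sigma> i)))"
  shows "emb m p \<preceq>\<^sub>V emb n q"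
proof -
  define ps where "ps = map (\<lambda>i. \<lambda>a\<in>vecs m. a ! \<sigma> i) [0..<n]"
  have "set ps \<subseteq> projections m" using assms(2) by (auto simp: ps_def projections_def)
  moreover have "snd (emb m p) = compose_fun m (snd (emb n q)) ps"
  proof
    fix v
    show "snd (emb m p) v = compose_fun m (snd (emb n q)) ps v"
    proof (cases "v \<in> vecs m")
      case True
      then have "snd (emb m p) v = q (\<lambda>i. v ! \<sigma> i)"
        by (simp add: emb_def assms(3))
      also have "\<dots> = q ((!) (map (\<lambda>g. g v) ps))"
        by (rule depends_belowD[OF assms(1)]) (use True in \<open>simp add: ps_def\<close>)
      also have "\<dots> = compose_fun m (snd (emb n q)) ps v"
        using True by (simp add: compose_fun_def emb_list ps_def)
      finally show ?thesis .
    qed (simp add: compose_fun_def emb_def)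
  qed
  moreover have "length ps = n" by (simp add: ps_def)
  ultimately show ?thesis unfolding minor_def by auto
qed

lemma depends_below_minor:
  assumes "depends_below n q" "\<And>i. i < n \<Longrightarrow> \<sigma> i < m"
  shows "depends_below m (\<lambda>a. q (\<lambda>i. a (\<sigma> i)))"
  unfolding depends_below_def
proof (intro allI impI)
  fix a b :: "nat \<Rightarrow> bool" assume "\<forall>i<m. a i = b i"
  then have "a (\<sigma> i) = b (\<sigma> i)" if "i < n" for i using assms(2)[OF that] by blast
  then show "q (\<lambda>i. a (\<sigma> i)) = q (\<lambda>i. b (\<sigma> i))" by (rule depends_belowD[OF assms(1)])
qed

lemma depends_below_comp:
  assumes "depends_below m p" "\<And>i. i < m \<Longrightarrow> depends_below m' (r i)"
  shows "depends_below m' (\<lambda>a. p (\<lambda>i. r i a))"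
  unfolding depends_below_def
proof (intro allI impI)
  fix a b :: "nat \<Rightarrow> bool" assume "\<forall>i<m'. a i = b i"
  then have "r i a = r i b" if "i < m" for i
    using assms(2)[OF that] unfolding depends_below_def by blast
  then show "p (\<lambda>i. r i a) = p (\<lambda>i. r i b)" by (rule depends_belowD[OF assms(1)])
qed

lemma minor_trans:
  assumes "F \<in> bool_functions" "G \<in> bool_functions" "H \<in> bool_functions"
    and "F \<preceq>\<^sub>V G" "G \<preceq>\<^sub>V H"
  shows "F \<preceq>\<^sub>V H"
proof -
  obtain m p where F: "depends_below m p" "F = emb m p"
    using assms(1) by (elim bool_functions_emb)
  obtain n q where G: "depends_below n q" "G = emb n q"
    using assms(2) by (elim bool_functions_emb)
  obtain l r where H: "depends_below l r" "H = emb l r"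
    using assms(3) by (elim bool_functions_emb)
  obtain \<sigma> where \<sigma>: "\<And>i. i < n \<Longrightarrow> \<sigma> i < m" "p = (\<lambda>a. q (\<lambda>i. a (\<sigma> i)))"
    using emb_minorD F G assms(4) by metis
  obtain \<tau> where \<tau>: "\<And>i. i < l \<Longrightarrow> \<tau> i < n" "q = (\<lambda>a. r (\<lambda>i. a (\<tau> i)))"
    using emb_minorD G H assms(5) by metis
  show ?thesis unfolding F(2) H(2)
    by (rule emb_minorI[OF H(1), where \<sigma> = "\<lambda>i. \<sigma> (\<tau> i)"]) (use \<sigma> \<tau> in auto)
qed

lemma minor_refl:
  assumes "F \<in> bool_functions"
  shows "F \<preceq>\<^sub>V F"
proof -
  obtain m p where F: "depends_below m p" "F = emb m p"
    using assms by (elim bool_functions_emb)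
  show ?thesis unfolding F(2)
    by (rule emb_minorI[OF F(1), where \<sigma> = "\<lambda>i. i"]) auto
qed

section \<open>Classes closed under composition\<close>

text \<open>Minors are a separate closure condition: a class need not contain projections, so
  identifying variables is not an instance of composition.\<close>

locale comp_closed =
  fixes P :: "nat \<Rightarrow> bfn \<Rightarrow> bool"
  assumes arity_pos: "P m p \<Longrightarrow> m \<ge> 1"
    and dep: "P m p \<Longrightarrow> depends_below m p"
    and minorI: "P m p \<Longrightarrow> m' \<ge> 1 \<Longrightarrow> (\<And>i. i < m \<Longrightarrow> \<sigma> i < m') \<Longrightarrow> P m' (\<lambda>a. p (\<lambda>i. a (\<sigma> i)))"
    and compI: "P m p \<Longrightarrow> (\<And>i. i < m \<Longrightarrow> P m' (r i)) \<Longrightarrow> P m' (\<lambda>a. p (\<lambda>i. r i a))"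

lemma comp_closed_class:
  assumes "equational_class C" "class_comp C C \<subseteq> C"
  shows "comp_closed (\<lambda>m p. depends_below m p \<and> emb m p \<in> C)"
proof
  have sub: "C \<subseteq> bool_functions" using assms(1) by (simp add: equational_class_def)
  have down: "G \<in> C" if "F \<in> C" "G \<in> bool_functions" "G \<preceq>\<^sub>V F" for F G
    using assms(1) that by (auto simp: equational_class_def)
  fix m p assume A: "depends_below m p \<and> emb m p \<in> C"
  show m1: "m \<ge> 1" using A sub by (auto simp: emb_def bool_functions_def)
  show "depends_below m p" using A by simp
  fix m'
  show "depends_below m' (\<lambda>a. p (\<lambda>i. a (\<sigma> i))) \<and> emb m' (\<lambda>a. p (\<lambda>i. a (\<sigma> i))) \<in> C"
    if "m' \<ge> 1" "\<And>i. i < m \<Longrightarrow> \<sigma> i < m'" for \<sigma>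
  proof
    show "depends_below m' (\<lambda>a. p (\<lambda>i. a (\<sigma> i)))"
      using depends_below_minor[of m p \<sigma> m'] that A by simp
    have "emb m' (\<lambda>a. p (\<lambda>i. a (\<sigma> i))) \<preceq>\<^sub>V emb m p"
      by (rule emb_minorI[where \<sigma> = \<sigma>]) (use A that in auto)
    then show "emb m' (\<lambda>a. p (\<lambda>i. a (\<sigma> i))) \<in> C"
      using down[OF _ emb_in_bool_functions] A that(1) by blast
  qed
  show "depends_below m' (\<lambda>a. p (\<lambda>i. r i a)) \<and> emb m' (\<lambda>a. p (\<lambda>i. r i a)) \<in> C"
    if r: "\<And>i. i < m \<Longrightarrow> depends_below m' (r i) \<and> emb m' (r i) \<in> C" for r
  proof
    show d: "depends_below m' (\<lambda>a. p (\<lambda>i. r i a))"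
      by (rule depends_below_comp[of m]) (use A r in auto)
    define gs where "gs = map (\<lambda>i. snd (emb m' (r i))) [0..<m]"
    have eq: "snd (emb m' (\<lambda>a. p (\<lambda>i. r i a))) = compose_fun m' (snd (emb m p)) gs"
    proof
      fix v
      show "snd (emb m' (\<lambda>a. p (\<lambda>i. r i a))) v = compose_fun m' (snd (emb m p)) gs v"
      proof (cases "v \<in> vecs m'")
        case True
        then have lv: "length v = m'" by (simp add: vecs_def)
        have "p (\<lambda>i. r i ((!) v)) = p ((!) (map (\<lambda>g. g v) gs))"
          by (rule depends_belowD[of m]) (use A lv in \<open>auto simp: gs_def emb_list\<close>)
        then show ?thesis using True lv
          by (simp add: compose_fun_def emb_list gs_def)
      qed (simp add: compose_fun_def emb_def)
    qed
    have "(m', compose_fun m' (snd (emb m p)) gs) \<in> class_comp C C"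
      unfolding class_comp_def mem_Collect_eq
    proof (intro exI conjI)
      show "(m', compose_fun m' (snd (emb m p)) gs) = (m', compose_fun m' (snd (emb m p)) gs)" ..
      show "(m, snd (emb m p)) \<in> C" using A by (simp add: emb_def)
      show "length gs = m" by (simp add: gs_def)
      show "\<forall>g\<in>set gs. (m', g) \<in> C" using r by (auto simp: gs_def emb_def)
    qed
    then have "(m', snd (emb m' (\<lambda>a. p (\<lambda>i. r i a)))) \<in> C"
      using assms(2) eq by auto
    then show "emb m' (\<lambda>a. p (\<lambda>i. r i a)) \<in> C"
      by (simp add: emb_def)
  qed
qed

text \<open>Kept free of any given class so that duality can be used: the dual of \<open>g\<close>
  need not lie in \<open>C2\<close>, but what it generates is dual to what \<open>g\<close>
  generates.\<close>

inductive generated :: "nat \<Rightarrow> bfn \<Rightarrow> nat \<Rightarrow> bfn \<Rightarrow> bool" for n g where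
  base: "generated n g n g"
| minor: "generated n g m p \<Longrightarrow> m' \<ge> 1 \<Longrightarrow> (\<And>i. i < m \<Longrightarrow> \<sigma> i < m') \<Longrightarrow>
    generated n g m' (\<lambda>a. p (\<lambda>i. a (\<sigma> i)))"
| comp: "generated n g m p \<Longrightarrow> (\<And>i. i < m \<Longrightarrow> generated n g m' (r i)) \<Longrightarrow>
    generated n g m' (\<lambda>a. p (\<lambda>i. r i a))"

lemma generated_closed:
  assumes "n \<ge> 1" "depends_below n g"
  shows "comp_closed (generated n g)"
proof
  show "m \<ge> 1" if "generated n g m p" for m p
    using that
  proof (induction)
    case (comp m p m' r)
    from comp.IH(1) have "0 < m" by simp
    then show ?case by (rule comp.IH(2))
  qed (use assms in auto)
  show "depends_below m p" if "generated n g m p" for m p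
    using that
  proof (induction)
    case (minor m p m' \<sigma>)
    show ?case by (rule depends_below_minor[OF minor.IH minor.hyps(3)])
  next
    case (comp m p m' r)
    show ?case by (rule depends_below_comp[OF comp.IH])
  qed (use assms in auto)
  fix m p m' assume p: "generated n g m p"
  show "generated n g m' (\<lambda>a. p (\<lambda>i. a (\<sigma> i)))"
    if "m' \<ge> 1" "\<And>i. i < m \<Longrightarrow> \<sigma> i < m'" for \<sigma>
    using p that by (rule generated.minor)
  show "generated n g m' (\<lambda>a. p (\<lambda>i. r i a))" if "\<And>i. i < m \<Longrightarrow> generated n g m' (r i)" for r
    using p that by (rule generated.comp)
qed

lemma (in comp_closed) generated_le:
  assumes "P n g" "generated n g m p"
  shows "P m p"
  using assms(2)
proof induction
  case base
  show ?case by (rule assms(1))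
next
  case (minor m p m' \<sigma>)
  show ?case by (rule minorI[OF minor.IH minor.hyps(2,3)])
next
  case (comp m p m' r)
  show ?case by (rule compI[OF comp.IH])
qed

section \<open>An antichain of threshold functions\<close>

text \<open>For \<open>k \<ge> 3\<close> the threshold is reached in two ways: by variable 0 and at
  least two of the others, or by at least \<open>k - 1\<close> of the others.\<close>

definition beta :: "nat \<Rightarrow> bfn" where
  "beta k a \<longleftrightarrow> k - 1 \<le> card {i\<in>{1..k}. a i} + (if a 0 then k - 3 else 0)"

definition monotone_fn :: "bfn \<Rightarrow> bool" where
  "monotone_fn p \<longleftrightarrow> (\<forall>a b. (\<forall>i. a i \<longrightarrow> b i) \<longrightarrow> p a \<longrightarrow> p b)"

definition self_dual :: "bfn \<Rightarrow> bool" where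
  "self_dual p \<longleftrightarrow> (\<forall>a. p (\<lambda>i. \<not> a i) = (\<not> p a))"

lemma depends_below_beta: "depends_below (k + 1) (beta k)"
proof -
  have "beta k a = beta k b" if "\<forall>i<k + 1. a i = b i" for a b
  proof -
    have "{i\<in>{1..k}. a i} = {i\<in>{1..k}. b i}" using that by auto
    moreover have "a 0 = b 0" using that by simp
    ultimately show ?thesis by (simp add: beta_def)
  qed
  then show ?thesis unfolding depends_below_def by blast
qed

lemma monotone_beta: "monotone_fn (beta k)"
proof -
  have "beta k b" if "\<forall>i. a i \<longrightarrow> b i" "beta k a" for a b
  proof -
    have "card {i\<in>{1..k}. a i} \<le> card {i\<in>{1..k}. b i}" using that(1) by (intro card_mono) auto
    then show ?thesis using that by (auto simp: beta_def split: if_splits)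
  qed
  then show ?thesis unfolding monotone_fn_def by blast
qed

text \<open>The weights reached by a point and by its complement add up to \<open>2 * k - 3\<close>,
  so exactly one of them is at least \<open>k - 1\<close>. The bound on \<open>k\<close> makes the
  subtraction in \<open>k - 3\<close> a true one.\<close>

lemma self_dual_beta:
  assumes "k \<ge> 3"
  shows "self_dual (beta k)"
proof -
  have "beta k (\<lambda>i. \<not> a i) = (\<not> beta k a)" for a
  proof -
    have "{i\<in>{1..k}. \<not> a i} = {1..k} - {i\<in>{1..k}. a i}" by auto
    also have "card \<dots> = card {1..k} - card {i\<in>{1..k}. a i}"
      by (rule card_Diff_subset) auto
    finally have "card {i\<in>{1..k}. \<not> a i} = k - card {i\<in>{1..k}. a i}" by simp
    moreover have "card {i\<in>{1..k}. a i} \<le> card {1..k}" by (intro card_mono) auto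
    ultimately show ?thesis using assms by (auto simp: beta_def)
  qed
  then show ?thesis unfolding self_dual_def by blast
qed

lemma beta_const:
  assumes "k \<ge> 3"
  shows "beta k (\<lambda>_. x) = x"
proof -
  have "{i\<in>{1..k}. x} = (if x then {1..k} else {})" by auto
  moreover have "k - 1 \<le> k + (k - 3)" using assms by linarith
  ultimately show ?thesis using assms unfolding beta_def by simp
qed

text \<open>The new variables \<open>y\<close> occupy the positions from \<open>n\<close> on;
  position \<open>n\<close> is the heavy one.\<close>

definition extension :: "nat \<Rightarrow> ((nat \<Rightarrow> bool) \<Rightarrow> bool \<Rightarrow> bool) \<Rightarrow> nat \<Rightarrow> bfn" where
  "extension n G k = (\<lambda>a. G a (beta k (\<lambda>i. a (n + i))))"

lemma depends_below_extension:
  assumes "\<And>y. depends_below n (\<lambda>a. G a y)"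
  shows "depends_below (n + k + 1) (extension n G k)"
  unfolding depends_below_def
proof (intro allI impI)
  fix a b :: "nat \<Rightarrow> bool" assume ab: "\<forall>i<n + k + 1. a i = b i"
  have "beta k (\<lambda>i. a (n + i)) = beta k (\<lambda>i. b (n + i))"
    by (rule depends_belowD[OF depends_below_beta]) (use ab in auto)
  moreover have "G a y = G b y" for y
    by (rule depends_belowD[OF assms]) (use ab in auto)
  ultimately show "extension n G k a = extension n G k b" by (simp add: extension_def)
qed

text \<open>The weights \<open>w\<close> describe how an identification of variables distributes the arguments of
  \<open>beta j\<close> (one of weight \<open>j - 3\<close>, the others of weight 1); \<open>c\<close> and \<open>c0\<close> are the weights landing
  on variables that are fixed to true and to false, \<open>s\<close> is the weight landing on the special
  argument of \<open>beta i\<close>, and \<open>U\<close> contains the arguments not hit by the remaining variables.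
  The conditions force the heavy argument to land on the special argument.\<close>

lemma weights_unique:
  fixes w u :: "nat \<Rightarrow> nat" and I U :: "nat set"
  assumes fin: "finite I" and U: "U \<subseteq> I" "card U \<ge> 7" and j: "j \<ge> 4"
    and total: "c0 + c + s + sum w I = 2 * j - 3"
    and heavy: "j - 3 \<le> c \<or> j - 3 \<le> c0 \<or> j - 3 \<le> s \<or> (\<exists>a\<in>I. j - 3 \<le> w a)"
    and low: "\<And>a b. a \<in> I \<Longrightarrow> b \<in> U \<Longrightarrow> a \<noteq> b \<Longrightarrow> c + s + w a \<le> j - 2 \<and> j - 1 \<le> c + s + w a + w b"
    and high: "\<And>a b. a \<in> I \<Longrightarrow> b \<in> U \<Longrightarrow> a \<noteq> b \<Longrightarrow> c0 + s + w a \<le> j - 2 \<and> j - 1 \<le> c0 + s + w a + w b"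
  shows "card I = j"
proof -
  have finU: "finite U" using fin U(1) finite_subset by blast
  have w1: "w b \<ge> 1" if "b \<in> U" for b
  proof -
    have "\<not> U \<subseteq> {b}"
    proof
      assume "U \<subseteq> {b}"
      then have "card U \<le> card {b}" by (intro card_mono) auto
      with U(2) show False by simp
    qed
    then obtain a where "a \<in> U" "a \<noteq> b" by blast
    with low[of a b] that U(1) j show ?thesis by (auto simp: subset_iff)
  qed
  \<comment> \<open>This is where 7 comes from: four elements form two disjoint pairs, and at least
    three more of weight at least 1 remain. Adding \<open>low\<close> for one pair to
    \<open>high\<close> for the other gives \<open>c + c0 + 2 * s + sum w T \<ge> 2 * j - 2\<close>,
    while \<open>total\<close> leaves at most \<open>2 * j - 6\<close> for
    \<open>c0 + c + s + sum w T\<close>. Hence \<open>s \<ge> 4\<close>.\<close>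
  obtain T where T: "T \<subseteq> U" "card T = 4" using U(2) obtain_subset_with_card_n[of 4 U] by auto
  then obtain p q p' q' where pq: "T = {p, q, p', q'}" "distinct [p, q, p', q']"
    by (auto simp: card_Suc_eq numeral_eq_Suc)
  have sumT: "sum w T = w p + w q + w p' + w q'" using pq by simp
  have "sum w (U - T) \<ge> card (U - T)" using w1
    by (metis DiffD1 card_eq_sum sum_mono)
  moreover have "card (U - T) \<ge> 3" using T U(2) finU by (simp add: card_Diff_subset finite_subset)
  moreover have "sum w I \<ge> sum w T + sum w (U - T)"
  proof -
    have "sum w T + sum w (U - T) = sum w U" using T(1) finU by (metis add.commute sum.subset_diff)
    also have "\<dots> \<le> sum w I" using U(1) fin by (intro sum_mono2) auto
    finally show ?thesis .
  qed
  moreover have "j - 1 \<le> c + s + w p + w q" "j - 1 \<le> c0 + s + w p' + w q'"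
    using low[of p q] high[of p' q'] pq T(1) U(1) by auto
  ultimately have s4: "s \<ge> 4" using total sumT j by linarith
  have p: "p \<in> I" "p \<in> U" "q \<in> I" "q \<in> U" "p \<noteq> q" using pq T(1) U(1) by auto
  have wle: "c + s + w a \<le> j - 2" "c0 + s + w a \<le> j - 2" if "a \<in> I" for a
  proof -
    obtain b where "b \<in> U" "b \<noteq> a" using p by metis
    then show "c + s + w a \<le> j - 2" "c0 + s + w a \<le> j - 2" using low[of a b] high[of a b] that by auto
  qed
  \<comment> \<open>If the heavy argument landed elsewhere, its weight together with
    \<open>s \<ge> 4\<close> would be at least \<open>j + 1\<close>, against the bound
    \<open>j - 2\<close> in \<open>wle\<close>.\<close>
  have sj: "j - 3 \<le> s"
    using heavy
  proof (elim disjE bexE)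
    assume "j - 3 \<le> c" then show ?thesis using wle[OF p(1)] s4 j by linarith
  next
    assume "j - 3 \<le> c0" then show ?thesis using wle[OF p(1)] s4 j by linarith
  next
    fix a assume "a \<in> I" "j - 3 \<le> w a" then show ?thesis using wle[of a] s4 j by linarith
  qed
  have cs: "c = 0" "c0 = 0" "s = j - 3" using sj wle[OF p(1)] w1[OF p(2)] j by linarith+
  have "w a = 1" if "a \<in> I" for a
  proof -
    obtain b where b: "b \<in> U" "b \<noteq> a" using p by metis
    have "w a \<le> 1" using wle[OF that] cs j by linarith
    moreover have "w b \<le> 1" using wle[of b] b U(1) cs j by (auto simp: subset_iff)
    moreover have "j - 1 \<le> c + s + w a + w b" using low[of a b] that b by auto
    ultimately show ?thesis using cs j by linarith
  qed
  then have "sum w I = card I" by simp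
  then show ?thesis using total cs j by linarith
qed

text \<open>Fix the first \<open>n\<close> arguments at a point \<open>d\<close> where
  \<open>G\<close> is sensitive to \<open>y\<close>, and change only light variables that
  \<open>\<sigma>\<close> does not feed into the first \<open>n\<close> arguments on the right. The
  change can then pass through \<open>beta j\<close> only, so \<open>beta j\<close> after
  identification must follow \<open>beta i\<close> across its threshold. This yields the
  inequalities of \<open>weights_unique\<close>. At most \<open>n\<close> light variables are
  excluded, hence the bound \<open>n + 7\<close>.\<close>

lemma extension_minor_unique:
  assumes dep: "\<And>y. depends_below n (\<lambda>a. G a y)"
    and sens: "G d False \<noteq> G d True"
    and ij: "i \<ge> n + 7" "j \<ge> n + 7"
    and \<sigma>: "\<And>t. t < n + j + 1 \<Longrightarrow> \<sigma> t < n + i + 1"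
    and eq: "extension n G i = (\<lambda>a. extension n G j (\<lambda>t. a (\<sigma> t)))"
  shows "i = j"
proof -
  \<comment> \<open>\<open>\<omega>\<close> holds the weights of \<open>beta j\<close>, and
    \<open>v t\<close> is the weight that the identification collects on variable
    \<open>t\<close>.\<close>
  define \<omega> :: "nat \<Rightarrow> nat" where "\<omega> = (\<lambda>s. if s = 0 then j - 3 else 1)"
  define v where "v t = sum \<omega> {s\<in>{..j}. \<sigma> (n + s) = t}" for t
  define c where "c = sum v {t\<in>{..<n}. d t}"
  define c0 where "c0 = sum v {t\<in>{..<n}. \<not> d t}"
  define w where "w b = v (n + b)" for b
  define I where "I = {1..i}"
  define U where "U = I - {b\<in>I. n + b \<in> \<sigma> ` {..<n}}"
  \<comment> \<open>The test points: \<open>d\<close> on the first block, \<open>z\<close> on the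
    special variable, and \<open>S\<close> the set of true light variables.\<close>
  define pt where "pt z S = (\<lambda>t. if t < n then d t else if t = n then z else t - n \<in> S)" for z S
  define B where "B z S = beta j (\<lambda>s. pt z S (\<sigma> (n + s)))" for z S
  have weight: "sum \<omega> {s\<in>{..j}. a (\<sigma> (n + s))} = sum v {t\<in>{..<n + i + 1}. a t}" for a
  proof -
    have "sum v {t\<in>{..<n + i + 1}. a t} =
        (\<Sum>t\<in>{t\<in>{..<n + i + 1}. a t}. sum \<omega> {s\<in>{s\<in>{..j}. a (\<sigma> (n + s))}. \<sigma> (n + s) = t})"
      unfolding v_def by (intro sum.cong arg_cong2[where f = sum] refl) auto
    also have "\<dots> = sum \<omega> {s\<in>{..j}. a (\<sigma> (n + s))}"
      by (rule sum.group) (use \<sigma> in auto)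
    finally show ?thesis by simp
  qed
  have beta_weight: "beta j x \<longleftrightarrow> j - 1 \<le> sum \<omega> {s\<in>{..j}. x s}" for x
  proof -
    have "{s\<in>{..j}. x s} = {s\<in>{1..j}. x s} \<union> (if x 0 then {0} else {})"
      by (auto simp: Suc_le_eq intro: gr0I)
    then have "sum \<omega> {s\<in>{..j}. x s} = sum \<omega> ({s\<in>{1..j}. x s} \<union> (if x 0 then {0} else {}))"
      by simp
    also have "\<dots> = sum \<omega> {s\<in>{1..j}. x s} + (if x 0 then \<omega> 0 else 0)"
      by (subst sum.union_disjoint) auto
    also have "sum \<omega> {s\<in>{1..j}. x s} = card {s\<in>{1..j}. x s}"
      by (simp add: \<omega>_def)
    finally show ?thesis by (simp add: beta_def \<omega>_def)
  qed
  have weight_pt: "sum v {t\<in>{..<n + i + 1}. pt z S t} = c + (if z then v n else 0) + sum w S"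
    if "S \<subseteq> I" for z S
  proof -
    have "{t\<in>{..<n + i + 1}. pt z S t} =
        {t\<in>{..<n}. d t} \<union> ((if z then {n} else {}) \<union> (+) n ` S)" (is "_ = ?A \<union> (?B \<union> ?C)")
    proof (intro equalityI subsetI)
      fix t assume t: "t \<in> {t\<in>{..<n + i + 1}. pt z S t}"
      consider "t < n" | "t = n" | "t > n" by linarith
      then show "t \<in> ?A \<union> (?B \<union> ?C)"
      proof cases
        case 3
        then have "t - n \<in> S" "t = n + (t - n)" using t by (auto simp: pt_def)
        then show ?thesis by blast
      qed (use t in \<open>auto simp: pt_def split: if_splits\<close>)
    next
      fix t assume "t \<in> ?A \<union> (?B \<union> ?C)"
      then show "t \<in> {t\<in>{..<n + i + 1}. pt z S t}"
        using that by (auto simp: pt_def I_def split: if_splits)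
    qed
    moreover have fin: "finite S" using that finite_subset I_def by blast
    have "0 \<notin> S" using that by (auto simp: I_def)
    then have "n \<notin> ?C" by auto
    with fin have "sum v (?B \<union> ?C) = sum v ?B + sum v ?C"
      by (intro sum.union_disjoint) auto
    moreover have "sum v (?A \<union> (?B \<union> ?C)) = sum v ?A + sum v (?B \<union> ?C)"
      using fin by (intro sum.union_disjoint) auto
    ultimately have "sum v {t\<in>{..<n + i + 1}. pt z S t} = sum v ?A + (sum v ?B + sum v ?C)"
      by simp
    also have "sum v ?C = sum w S" by (simp add: sum.reindex w_def)
    finally show ?thesis by (simp add: c_def)
  qed
  have B_weight: "B z S \<longleftrightarrow> j - 1 \<le> c + (if z then v n else 0) + sum w S" if "S \<subseteq> I" for z S
    unfolding B_def beta_weight weight weight_pt[OF that] ..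
  have beta_pt: "beta i (\<lambda>s. pt z S (n + s)) \<longleftrightarrow> i - 1 \<le> card S + (if z then i - 3 else 0)"
    if "S \<subseteq> I" for z S
  proof -
    have "{s\<in>{1..i}. pt z S (n + s)} = S" using that by (auto simp: pt_def I_def)
    then show ?thesis by (simp add: beta_def pt_def)
  qed
  \<comment> \<open>Since \<open>S\<close> and \<open>S'\<close> differ only inside
    \<open>U\<close>, the first \<open>n\<close> arguments on the right agree at both points; they
    are called \<open>q\<close>. The change of \<open>beta i\<close> must then be matched by a
    change of \<open>B\<close>, and monotonicity of the weights gives its direction.\<close>
  have key: "\<not> B z S \<and> B z S'"
    if S: "S \<subseteq> S'" "S' \<subseteq> I" "S' - S \<subseteq> U"
      and b: "\<not> beta i (\<lambda>s. pt z S (n + s))" "beta i (\<lambda>s. pt z S' (n + s))" for z S S'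
  proof -
    define q where "q = (\<lambda>t. pt z S (\<sigma> t))"
    have "G d (beta i (\<lambda>s. pt z T (n + s))) = G q (B z T)" if T: "T = S \<or> T = S'" for T
    proof -
      have "G d y = G (pt z T) y" for y
        by (rule depends_belowD[OF dep]) (simp add: pt_def)
      moreover have "G (\<lambda>t. pt z T (\<sigma> t)) y = G q y" for y
      proof (rule depends_belowD[OF dep])
        fix t assume t: "t < n"
        show "pt z T (\<sigma> t) = q t"
        proof (cases "\<sigma> t \<le> n")
          case False
          then have "\<sigma> t - n \<in> I" using \<sigma>[of t] t by (auto simp: I_def)
          moreover have "n + (\<sigma> t - n) \<in> \<sigma> ` {..<n}" using False t by auto
          ultimately have "\<sigma> t - n \<notin> U" by (auto simp: U_def)
          then show ?thesis using False T S by (auto simp: q_def pt_def)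
        qed (auto simp: q_def pt_def)
      qed
      ultimately show ?thesis
        using fun_cong[OF eq, of "pt z T"] by (simp add: extension_def B_def)
    qed
    from this[of S] this[of S'] b sens have "B z S \<noteq> B z S'"
      by (cases "B z S"; cases "B z S'") auto
    moreover have "B z S \<Longrightarrow> B z S'"
    proof -
      have "finite S'" using S(2) finite_subset by (auto simp: I_def)
      then have "sum w S \<le> sum w S'" using S(1) by (intro sum_mono2) auto
      then show "B z S \<Longrightarrow> B z S'"
        using B_weight[of S z] B_weight[of S' z] S(1,2) by (auto split: if_splits)
    qed
    ultimately show ?thesis by blast
  qed
  have total: "c0 + c + v n + sum w I = 2 * j - 3"
  proof -
    have "{t\<in>{..<n + i + 1}. True} = {..<n + i + 1}" "{s\<in>{..j}. True} = {..j}" by auto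
    then have "sum v {..<n + i + 1} = sum \<omega> {..j}"
      using weight[of "\<lambda>_. True"] by (simp only:)
    also have "\<dots> = \<omega> 0 + sum \<omega> {1..j}"
      by (simp add: atMost_atLeast0 sum.atLeast_Suc_atMost)
    also have "\<dots> = 2 * j - 3" using ij by (simp add: \<omega>_def)
    finally have "sum v {..<n + i + 1} = 2 * j - 3" .
    moreover have "sum v {..<n + i + 1} = sum v {..<n} + sum v {n..<n + i + 1}"
      using sum.atLeastLessThan_concat[of 0 n "n + i + 1" v] by (simp add: atLeast0LessThan)
    moreover have "sum v {n..<n + i + 1} = v n + sum w I"
    proof -
      have "sum v {n..<n + i + 1} = sum w {0..<i + 1}"
        using sum.shift_bounds_nat_ivl[of v 0 n "i + 1"] by (simp add: w_def add.commute)
      also have "\<dots> = w 0 + sum w {1..i}"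
        by (subst sum.atLeast_Suc_lessThan) (auto simp: atLeastLessThanSuc_atLeastAtMost)
      finally show ?thesis by (simp add: w_def I_def)
    qed
    moreover have "sum v {..<n} = c + c0"
      unfolding c_def c0_def by (subst sum.union_disjoint[symmetric]) (auto intro!: sum.cong)
    ultimately show ?thesis by simp
  qed
  have "card I = j"
  proof (rule weights_unique[where U = U and w = w and c = c and ?c0.0 = c0 and s = "v n"])
    show "finite I" by (simp add: I_def)
    show "U \<subseteq> I" by (auto simp: U_def)
    have "card {b\<in>I. n + b \<in> \<sigma> ` {..<n}} \<le> n"
    proof -
      have "card {b\<in>I. n + b \<in> \<sigma> ` {..<n}} = card ((+) n ` {b\<in>I. n + b \<in> \<sigma> ` {..<n}})"
        by (simp add: card_image)
      also have "\<dots> \<le> card (\<sigma> ` {..<n})" by (intro card_mono) auto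
      also have "\<dots> \<le> n" using card_image_le[of "{..<n}" \<sigma>] by simp
      finally show ?thesis .
    qed
    moreover have "card U = card I - card {b\<in>I. n + b \<in> \<sigma> ` {..<n}}"
      unfolding U_def by (rule card_Diff_subset) (auto simp: I_def)
    ultimately show "card U \<ge> 7" using ij by (simp add: I_def)
    show "j \<ge> 4" using ij by simp
    show "c0 + c + v n + sum w I = 2 * j - 3" by (rule total)
    \<comment> \<open>Argument \<open>n\<close> on the right is the heavy one; the cases say where
      it is mapped.\<close>
    have "v (\<sigma> n) \<ge> \<omega> 0"
      unfolding v_def by (rule member_le_sum) auto
    then have h: "v (\<sigma> n) \<ge> j - 3" by (simp add: \<omega>_def)
    consider "\<sigma> n < n" "d (\<sigma> n)" | "\<sigma> n < n" "\<not> d (\<sigma> n)" | "\<sigma> n = n" | "\<sigma> n > n" by linarith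
    then show "j - 3 \<le> c \<or> j - 3 \<le> c0 \<or> j - 3 \<le> v n \<or> (\<exists>a\<in>I. j - 3 \<le> w a)"
    proof cases
      case 1
      then have "v (\<sigma> n) \<le> c" unfolding c_def by (intro member_le_sum) auto
      with h show ?thesis by simp
    next
      case 2
      then have "v (\<sigma> n) \<le> c0" unfolding c0_def by (intro member_le_sum) auto
      with h show ?thesis by simp
    next
      case 3
      with h show ?thesis by simp
    next
      case 4
      then have "\<sigma> n - n \<in> I" "w (\<sigma> n - n) = v (\<sigma> n)"
        using \<sigma>[of n] by (auto simp: I_def w_def)
      with h show ?thesis by metis
    qed
  next
    fix a b assume ab: "a \<in> I" "b \<in> U" "a \<noteq> b"
    then have bI: "b \<in> I" by (simp add: U_def)
    have fI: "finite I" and cI: "card I = i" by (simp_all add: I_def)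
    \<comment> \<open>With the special variable true, \<open>{a}\<close> has weight
      \<open>i - 2\<close> for \<open>beta i\<close>, and adding \<open>b\<close> just reaches the
      threshold.\<close>
    have "\<not> B True {a} \<and> B True {a, b}"
      by (rule key) (use ab bI ij in \<open>auto simp: beta_pt\<close>)
    then show "c + v n + w a \<le> j - 2 \<and> j - 1 \<le> c + v n + w a + w b"
      using ab bI by (auto simp: B_weight)
    have cards: "card (I - {a, b}) = i - 2" "card (I - {a}) = i - 1"
      using ab bI fI cI by (auto simp: card_Diff_subset)
    \<comment> \<open>The complementary test: with the special variable false, removing
      \<open>a\<close> leaves weight \<open>i - 1\<close>, and removing \<open>b\<close> as well
      falls short. Subtracting from \<open>total\<close> turns this into the bounds on
      \<open>c0\<close>.\<close>
    have "\<not> B False (I - {a, b}) \<and> B False (I - {a})"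
      by (rule key) (use ab bI ij cards in \<open>auto simp: beta_pt\<close>)
    then have "\<not> (j - 1 \<le> c + sum w (I - {a, b}))" "j - 1 \<le> c + sum w (I - {a})"
      using B_weight[of "I - {a, b}" False] B_weight[of "I - {a}" False] by auto
    moreover have "sum w I = w a + sum w (I - {a})"
      using fI ab by (intro sum.remove)
    moreover have "I - {a} - {b} = I - {a, b}" by auto
    then have "sum w (I - {a}) = w b + sum w (I - {a, b})"
      using fI ab bI sum.remove[of "I - {a}" b w] by simp
    ultimately show "c0 + v n + w a \<le> j - 2 \<and> j - 1 \<le> c0 + v n + w a + w b"
      using total ij by (intro conjI) linarith+
  qed
  then show ?thesis by (simp add: I_def)
qed

section \<open>Associative Boolean functions\<close>

definition affine :: "nat \<Rightarrow> bfn \<Rightarrow> bool" where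
  "affine n p \<longleftrightarrow> (\<exists>S\<subseteq>{..<n}. \<exists>c. \<forall>a. p a = (c \<noteq> odd (card {i\<in>S. a i})))"

definition conjunctive :: "nat \<Rightarrow> bfn \<Rightarrow> bool" where
  "conjunctive n p \<longleftrightarrow> (\<exists>S\<subseteq>{..<n}. S \<noteq> {} \<and> (\<forall>a. p a = (\<forall>i\<in>S. a i)))"

definition disjunctive :: "nat \<Rightarrow> bfn \<Rightarrow> bool" where
  "disjunctive n p \<longleftrightarrow> (\<exists>S\<subseteq>{..<n}. S \<noteq> {} \<and> (\<forall>a. p a = (\<exists>i\<in>S. a i)))"

text \<open>Constants enter only as affine functions with empty \<open>S\<close>; this is why the
  other two kinds require a nonempty \<open>S\<close>.\<close>

definition simple :: "nat \<Rightarrow> bfn \<Rightarrow> bool" where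
  "simple n p \<longleftrightarrow> affine n p \<or> conjunctive n p \<or> disjunctive n p"

text \<open>Positions are replaced by factorizations of one word of length \<open>2 * n - 1\<close>,
  so that moving the inner block becomes a list equation.\<close>

lemma associative_eq:
  assumes "associative (n, f)"
    and "length u + length v = n - 1" "length u' + length v' = n - 1" "n \<ge> 1"
    and "length b = n" "length b' = n" "u @ b @ v = u' @ b' @ v'"
  shows "f (u @ f b # v) = f (u' @ f b' # v')"
proof -
  have val: "inner_applied_at n f (length w) xs = f (w @ f c # y)"
    if "xs = w @ c @ y" "length c = n" for w c y xs
    using that by (simp add: inner_applied_at_def)
  have len: "u @ b @ v \<in> vecs (2 * n - 1)" using assms by (simp add: vecs_def)
  have lt: "inner_applied_at n f i xs = inner_applied_at n f j xs"
    if "i < j" "j < n" "xs \<in> vecs (2 * n - 1)" for i j xs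
    using assms(1) that by (auto simp: associative_def)
  have *: "inner_applied_at n f i xs = inner_applied_at n f j xs"
    if "i < n" "j < n" "xs \<in> vecs (2 * n - 1)" for i j xs
    using lt[of i j xs] lt[of j i xs] that by (metis linorder_neqE_nat)
  have "length u < n" "length u' < n" using assms(2-4) by linarith+
  then have "inner_applied_at n f (length u) (u @ b @ v) = inner_applied_at n f (length u') (u @ b @ v)"
    using len by (rule *)
  then show ?thesis
    using val[of "u @ b @ v" u b v] val[of "u @ b @ v" u' b' v'] assms(5-7) by simp
qed

section \<open>Classification of the associative functions of arity at least two\<close>

locale assoc_fn =
  fixes n :: nat and f :: "bool list \<Rightarrow> bool"
  assumes assoc: "associative (n, f)" and n2: "n \<ge> 2"
begin

lemma shift:
  assumes "u @ b @ v = u' @ b' @ v'" "length b = n" "length b' = n" "length u + length v = n - 1"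
  shows "f (u @ f b # v) = f (u' @ f b' # v')"
proof (rule associative_eq[OF assoc])
  show "length u' + length v' = n - 1"
    using arg_cong[OF assms(1), of length] assms(2-4) by simp
qed (use assms n2 in auto)

abbreviation zs :: "nat \<Rightarrow> bool list" where "zs k \<equiv> replicate k False"

abbreviation ts :: "nat \<Rightarrow> bool list" where "ts k \<equiv> replicate k True"

abbreviation ones :: "bool list \<Rightarrow> nat" where "ones xs \<equiv> length (filter (\<lambda>x. x) xs)"

lemma n_split: "n = Suc (n - 1)" "n - 1 = Suc (n - 2)"
  using n2 by auto

lemma zs_pred: "zs (n - Suc 0) = False # zs (n - 2)" "zs n = False # zs (n - Suc 0)"
  using n2 by (simp_all flip: replicate_Suc add: numeral_2_eq_2 Suc_diff_Suc)

text \<open>On constant tuples \<open>f\<close> acts as negation. The steps \<open>left\<close> and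
  \<open>right\<close> extend this to a single end argument with False elsewhere, and
  \<open>neg\<close> to any argument in any context; a function that changes with every flip is a
  parity up to complement.\<close>

lemma parity_case:
  assumes D: "f (zs n)" "\<not> f (ts n)"
  shows "\<exists>c. \<forall>xs. length xs = n \<longrightarrow> f xs = (c \<noteq> odd (ones xs))"
proof -
  \<comment> \<open>Were the value True at \<open>True # zs (n - 1)\<close>, a leading block of True
    could be lengthened one entry at a time, up to \<open>ts n\<close>, where the value is
    False.\<close>
  have up: "f (ts k @ zs (n - k))" if "f (True # zs (n - 1))" "1 \<le> k" "k \<le> n" for k
    using that(2,3)
  proof (induction k rule: dec_induct)
    case base
    then show ?case using that(1) by simp
  next
    case (step k)
    have "f ([] @ f (ts k @ zs (n - k)) # zs (n - 1)) = f (ts k @ f (zs n) # zs (n - 1 - k))"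
    proof (rule shift)
      have "zs (n - k) @ zs (n - 1) = zs n @ zs (n - 1 - k)"
        using step by (simp flip: replicate_add)
      then show "[] @ (ts k @ zs (n - k)) @ zs (n - 1) = ts k @ zs n @ zs (n - 1 - k)" by simp
    qed (use step in auto)
    then have "f (ts k @ True # zs (n - 1 - k))" using step D(1) that(1) by simp
    moreover have "ts (Suc k) @ zs (n - Suc k) = ts k @ True # zs (n - 1 - k)"
      by (simp add: replicate_app_Cons_same)
    ultimately show ?case by simp
  qed
  have left: "f (x # zs (n - 1)) = (\<not> x)" for x
    using up[of n] D n2 n_split(1) by (cases x) (auto simp flip: replicate_Suc)
  have right: "f (zs (n - 1) @ [x]) = (\<not> x)" for x
  proof (cases x)
    case True
    have "f ([] @ f (zs (n - 1) @ [True]) # zs (n - 1)) = f (zs (n - 1) @ f (True # zs (n - 1)) # [])"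
      by (rule shift) (use n_split in auto)
    then show ?thesis using left[of "f (zs (n - 1) @ [True])"] left[of True] D(1) True zs_pred
      by (auto simp: replicate_append_same)
  next
    case False
    then show ?thesis using D(1) by (simp add: replicate_append_same zs_pred(2))
  qed
  \<comment> \<open>Moving the inner block by one place turns a negation of \<open>x\<close> into a
    negation of its left neighbour, so the claim travels from the first position to all
    others.\<close>
  have neg: "f (u @ (\<not> x) # v) = (\<not> f (u @ x # v))" if "length u + length v = n - 1" for u x v
    using that
  proof (induction u arbitrary: x v rule: rev_induct)
    case Nil
    have "f ([] @ f (zs (n - 1) @ [x]) # v) = f (zs (n - 1) @ f (x # v) # [])"
      by (rule shift) (use Nil n2 in auto)
    then show ?case using right[of x] right[of "f (x # v)"] by simp
  next
    case (snoc y u)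
    have "f (u @ f (y # zs (n - 1)) # x # v) = f ((u @ [y]) @ f (zs (n - 1) @ [x]) # v)"
      by (rule shift) (use snoc.prems n2 in auto)
    then have "f ((u @ [y]) @ (\<not> x) # v) = f (u @ (\<not> y) # x # v)"
      using left[of y] right[of x] by simp
    also have "\<dots> = (\<not> f (u @ y # x # v))" by (rule snoc.IH) (use snoc.prems in simp)
    finally show ?case by simp
  qed
  have "f (zs (n - length ys) @ ys) = (True \<noteq> odd (ones ys))" if "length ys \<le> n" for ys
    using that
  proof (induction ys)
    case Nil
    then show ?case using D(1) by simp
  next
    case (Cons y ys)
    have "n - length ys = Suc (n - length (y # ys))" using Cons.prems by simp
    then have *: "zs (n - length ys) @ ys = zs (n - length (y # ys)) @ False # ys"
      by (simp only:) (simp add: replicate_app_Cons_same)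
    have "f (zs (n - length (y # ys)) @ (\<not> False) # ys) = (\<not> f (zs (n - length (y # ys)) @ False # ys))"
      by (rule neg) (use Cons.prems in simp)
    then show ?case using Cons * by (cases y) auto
  qed
  from this[of xs for xs] have "\<forall>xs. length xs = n \<longrightarrow> f xs = (True \<noteq> odd (ones xs))"
    by (metis append_Nil diff_self_eq_0 order_refl replicate_0)
  then show ?thesis ..
qed

text \<open>False is neutral at both ends. This first makes every point with a single True have
  value True, then allows adjacent entries to be swapped, so that \<open>f\<close> depends only on
  the number of True entries. The value at two True entries separates disjunction from
  parity.\<close>

lemma neutral_case:
  assumes D: "\<not> f (zs n)" and h: "f (True # zs (n - 1))" and k: "f (zs (n - 1) @ [True])"
  shows "(\<forall>xs. length xs = n \<longrightarrow> f xs = odd (ones xs)) \<or>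
    (\<forall>xs. length xs = n \<longrightarrow> f xs = (\<exists>x\<in>set xs. x))"
proof -
  have single: "f (zs i @ True # zs (n - 1 - i))" if "i < n" for i
  proof -
    have "f (zs (n - 1) @ f (True # zs (n - 1)) # []) =
        f (zs (n - 1 - i) @ f (zs i @ True # zs (n - 1 - i)) # zs i)"
    proof (rule shift)
      have "zs (n - 1 - i) @ zs i = zs (n - 1)" "zs (n - 1 - i) @ zs i = zs (n - 1)"
        using that by (simp_all flip: replicate_add)
      then show "zs (n - 1) @ (True # zs (n - 1)) @ [] =
          zs (n - 1 - i) @ (zs i @ True # zs (n - 1 - i)) @ zs i"
        by (metis append.assoc append_Cons append_Nil2)
    qed (use that n2 in auto)
    then have "f (zs (n - 1 - i) @ f (zs i @ True # zs (n - 1 - i)) # zs i)" using h k by simp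
    moreover have "zs (n - 1 - i) @ False # zs i = zs n"
      using that n2 by (simp flip: replicate_Suc replicate_add)
    ultimately show ?thesis using D by (metis (full_types))
  qed
  have swap: "f (u @ False # x # v) = f (u @ x # False # v)" if "length u + length v = n - 2" for u x v
  proof (cases x)
    case True
    have "f ((u @ [False]) @ f (True # zs (n - 1)) # v) = f (u @ f (False # True # zs (n - 2)) # False # v)"
      by (rule shift) (use that n2 in \<open>auto simp: zs_pred replicate_app_Cons_same\<close>)
    moreover have "f (False # True # zs (n - 2))" using single[of 1] n2 by (simp add: numeral_2_eq_2)
    ultimately show ?thesis using h True by simp
  qed simp
  have move: "f (u @ False # ts w @ v) = f (u @ ts w @ False # v)" if "length u + w + length v = n - 1" for u w v
    using that
  proof (induction w arbitrary: u)
    case (Suc w)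
    have "f (u @ False # True # ts w @ v) = f (u @ True # False # ts w @ v)"
      by (rule swap) (use Suc.prems in simp)
    with Suc.IH[of "u @ [True]"] Suc.prems show ?case by simp
  qed simp
  define s where "s w = f (ts w @ zs (n - w))" for w
  have "f (u @ ys) = f (u @ ts (ones ys) @ zs (length ys - ones ys))" if "length u + length ys = n" for u ys
    using that
  proof (induction ys arbitrary: u)
    case (Cons y ys)
    show ?case
    proof (cases y)
      case True
      with Cons.IH[of "u @ [True]"] Cons.prems show ?thesis by simp
    next
      case False
      have le: "ones ys \<le> length ys" by (rule length_filter_le)
      have "f (u @ False # ys) = f (u @ False # ts (ones ys) @ zs (length ys - ones ys))"
        using Cons.IH[of "u @ [False]"] Cons.prems by simp
      also have "\<dots> = f (u @ ts (ones ys) @ False # zs (length ys - ones ys))"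
        by (rule move) (use Cons.prems le in simp)
      finally show ?thesis using False le by (simp add: Suc_diff_le)
    qed
  qed simp
  from this[of "[]"] have count: "f xs = s (ones xs)" if "length xs = n" for xs
    using that by (simp add: s_def)
  have s01: "\<not> s 0" "s 1" using D h by (simp_all add: s_def)
  have ones_simps: "ones (ts a) = a" "ones (zs a) = 0" for a by (induction a) auto
  \<comment> \<open>One word read in two ways: the first block contains one True and returns True,
    which gives weight \<open>w\<close>; the block one place later contains two and returns
    \<open>s 2\<close>, which gives weight \<open>w - 1\<close> or \<open>w - 2\<close>.\<close>
  have rec: "s w = s (if s 2 then w - 1 else w - 2)" if "2 \<le> w" "w \<le> n" for w
  proof -
    obtain w' where w': "w = Suc (Suc w')" using \<open>2 \<le> w\<close> by (auto simp: numeral_2_eq_2 le_iff_add)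
    have "f ([] @ f (zs (n - 1) @ [True]) # ts (w - 1) @ zs (n - w)) =
        f ([False] @ f (zs (n - 2) @ [True, True]) # ts (w - 2) @ zs (n - w))"
      by (rule shift) (use that n2 in \<open>auto simp: w' zs_pred\<close>)
    moreover have "f (zs (n - 2) @ [True, True]) = s 2"
      using count[of "zs (n - 2) @ [True, True]"] n2 by (simp add: ones_simps numeral_2_eq_2)
    ultimately have "f (True # ts (w - 1) @ zs (n - w)) = f (False # s 2 # ts (w - 2) @ zs (n - w))"
      using k by simp
    then show ?thesis
      using count[of "True # ts (w - 1) @ zs (n - w)"] count[of "False # s 2 # ts (w - 2) @ zs (n - w)"] that
      by (simp add: ones_simps w' split: if_splits)
  qed
  show ?thesis
  proof (cases "s 2")
    case True
    have "s w" if "1 \<le> w" "w \<le> n" for w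
      using that
    proof (induction w rule: dec_induct)
      case (step m)
      then show ?case using rec[of "Suc m"] True by simp
    qed (use s01 in simp)
    then have "s w = (w \<noteq> 0)" if "w \<le> n" for w using s01 that by (cases w) auto
    then have "f xs = (\<exists>x\<in>set xs. x)" if "length xs = n" for xs
      using count[OF that] that length_filter_le[of "\<lambda>x. x" xs] by (auto simp: filter_empty_conv)
    then show ?thesis by blast
  next
    case False
    have "w \<le> n \<Longrightarrow> s w = odd w" for w
    proof (induction w rule: less_induct)
      case (less w)
      consider "w = 0" | "w = 1" | "w \<ge> 2" by linarith
      then show ?case
      proof cases
        case 3
        then show ?thesis using rec[of w] less False by simp
      qed (use s01 in auto)
    qed
    then show ?thesis using count length_filter_le by metis
  qed
qed

lemma left_zero:
  assumes "\<not> f (zs n)" "\<not> f (zs (n - 1) @ [True])" "length xs = n - 1"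
  shows "\<not> f (False # xs)"
proof
  assume *: "f (False # xs)"
  have "f ([] @ f (zs n) # xs) = f (zs (n - 1) @ f (False # xs) # [])"
    by (rule shift) (use assms n_split in \<open>auto simp: replicate_app_Cons_same simp flip: replicate_Suc\<close>)
  then show False using * assms by simp
qed

lemma right_zero:
  assumes "\<not> f (zs n)" "\<not> f (True # zs (n - 1))" "length xs = n - 1"
  shows "\<not> f (xs @ [False])"
proof
  assume *: "f (xs @ [False])"
  have "f (xs @ f (zs n) # []) = f ([] @ f (xs @ [False]) # zs (n - 1))"
    by (rule shift) (use assms n_split in \<open>auto simp flip: replicate_Suc\<close>)
  then show False using * assms by simp
qed

text \<open>The two points with a single True at an end tell which end lets a True through. Both:
  disjunction or parity. Only one: the projection to that end. Neither: False is absorbing in every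
  position, which leaves the full conjunction or the constant False.\<close>

lemma zero_case:
  assumes D: "\<not> f (zs n)"
  shows "(\<forall>xs. length xs = n \<longrightarrow> f xs = odd (ones xs)) \<or>
    (\<forall>xs. length xs = n \<longrightarrow> f xs = (\<exists>x\<in>set xs. x)) \<or>
    (\<forall>xs. length xs = n \<longrightarrow> f xs = hd xs) \<or> (\<forall>xs. length xs = n \<longrightarrow> f xs = last xs) \<or>
    (\<exists>c. \<forall>xs. length xs = n \<longrightarrow> f xs = (c \<and> (\<forall>x\<in>set xs. x)))"
proof -
  consider "f (True # zs (n - 1))" "f (zs (n - 1) @ [True])"
    | "f (True # zs (n - 1))" "\<not> f (zs (n - 1) @ [True])"
    | "\<not> f (True # zs (n - 1))" "f (zs (n - 1) @ [True])"
    | "\<not> f (True # zs (n - 1))" "\<not> f (zs (n - 1) @ [True])" by blast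
  then show ?thesis
  proof cases
    case 1
    then show ?thesis using neutral_case[OF D] by blast
  next
    case 2
    have "f xs = hd xs" if len: "length xs = n" for xs
    proof -
      obtain x ys where xs: "xs = x # ys" "length ys = n - 1" using len n2 by (cases xs) auto
      have "f (True # ys)"
      proof -
        have "f ([] @ f (True # zs (n - 1)) # ys) = f ((True # zs (n - 2)) @ f (False # ys) # [])"
          by (rule shift) (use xs n2 in \<open>auto simp: replicate_app_Cons_same zs_pred\<close>)
        moreover have "zs (n - 2) @ [False] = zs (n - 1)"
          by (simp add: replicate_append_same zs_pred)
        ultimately show ?thesis using 2 left_zero[OF D 2(2) xs(2)] by simp
      qed
      then show ?thesis using left_zero[OF D 2(2) xs(2)] xs by (cases x) auto
    qed
    then show ?thesis by blast
  next
    case 3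
    have "f xs = last xs" if len: "length xs = n" for xs
    proof -
      obtain x ys where xs: "xs = ys @ [x]" "length ys = n - 1" using len n2 by (cases xs rule: rev_cases) auto
      have "f (ys @ [True])"
      proof -
        have "f (ys @ f (zs (n - 1) @ [True]) # []) = f ([] @ f (ys @ [False]) # zs (n - 2) @ [True])"
          by (rule shift) (use xs n2 in \<open>auto simp: zs_pred\<close>)
        then show ?thesis using 3 right_zero[OF D 3(1) xs(2)] by (simp add: zs_pred)
      qed
      then show ?thesis using right_zero[OF D 3(1) xs(2)] xs by (cases x) auto
    qed
    then show ?thesis by blast
  next
    case 4
    have zero: "\<not> f (u @ False # v)" if "length u + length v = n - 1" for u v
    proof (cases "u = []")
      case True
      then show ?thesis using left_zero[OF D 4(2), of v] that by simp
    next
      case False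
      have u: "length u \<le> n - 1" "n - length u = Suc (n - 1 - length u)" using that n2 by linarith+
      \<comment> \<open>Moving the inner block to the front absorbs twice: the inner word ends in
        False, and its value then puts a False in front of the outer word.\<close>
      have "f (u @ f (zs n) # v) = f ([] @ f (u @ zs (n - length u)) # zs (length u) @ v)"
      proof (rule shift)
        have "zs n = zs (n - length u) @ zs (length u)"
          using that n2 by (simp flip: replicate_add)
        then show "u @ zs n @ v = [] @ (u @ zs (n - length u)) @ zs (length u) @ v" by simp
      qed (use that u in auto)
      moreover have "\<not> f (u @ zs (n - length u))"
        using right_zero[OF D 4(1), of "u @ zs (n - 1 - length u)"] u
        by (simp add: replicate_append_same)
      moreover have "\<not> f (False # zs (length u) @ v)"
        by (rule left_zero[OF D 4(2)]) (use that in simp)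
      ultimately show ?thesis using D by simp
    qed
    have "f xs = (f (ts n) \<and> (\<forall>x\<in>set xs. x))" if len: "length xs = n" for xs
    proof (cases "\<forall>x\<in>set xs. x")
      case True
      then have "xs = ts n" using len by (intro replicate_eqI) auto
      then show ?thesis by simp
    next
      case False
      then obtain u v where "xs = u @ False # v" using split_list by metis
      then show ?thesis using zero[of u v] len by auto
    qed
    then show ?thesis by blast
  qed
qed

end

lemma card_filter_map: "length (filter (\<lambda>x. x) (map a [0..<n])) = card {i\<in>{..<n}. a i}"
proof (induction n)
  case (Suc n)
  have "{i\<in>{..<Suc n}. a i} = {i\<in>{..<n}. a i} \<union> (if a n then {n} else {})"
    by (auto simp: less_Suc_eq)
  then show ?case using Suc by simp
qed simp

lemma simple_dual:
  assumes "simple n (\<lambda>a. \<not> p (\<lambda>i. \<not> a i))"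
  shows "simple n p"
proof -
  have eq: "p a = (\<not> (\<lambda>a. \<not> p (\<lambda>i. \<not> a i)) (\<lambda>i. \<not> a i))" for a by simp
  from assms consider "affine n (\<lambda>a. \<not> p (\<lambda>i. \<not> a i))"
    | "conjunctive n (\<lambda>a. \<not> p (\<lambda>i. \<not> a i))" | "disjunctive n (\<lambda>a. \<not> p (\<lambda>i. \<not> a i))"
    unfolding simple_def by blast
  then show ?thesis
  proof cases
    case 1
    then obtain S c where S: "S \<subseteq> {..<n}" "\<And>a. (\<not> p (\<lambda>i. \<not> a i)) = (c \<noteq> odd (card {i\<in>S. a i}))"
      unfolding affine_def by blast
    \<comment> \<open>Complementing the arguments adds \<open>card S\<close> to the parity, and
      complementing the value adds one more.\<close>
    have "p a = ((c = odd (card S)) \<noteq> odd (card {i\<in>S. a i}))" for a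
    proof -
      have fin: "finite S" using S(1) finite_subset by blast
      have "S = {i\<in>S. a i} \<union> {i\<in>S. \<not> a i}" by auto
      then have "card S = card ({i\<in>S. a i} \<union> {i\<in>S. \<not> a i})" by (rule arg_cong)
      also have "\<dots> = card {i\<in>S. a i} + card {i\<in>S. \<not> a i}"
        using fin by (intro card_Un_disjoint) auto
      finally have "odd (card {i\<in>S. \<not> a i}) = (odd (card S) \<noteq> odd (card {i\<in>S. a i}))"
        by presburger
      moreover have "(\<not> p a) = (c \<noteq> odd (card {i\<in>S. \<not> a i}))" using S(2)[of "\<lambda>i. \<not> a i"] by simp
      ultimately show ?thesis
        by (cases "even (card S)"; cases "even (card {i\<in>S. a i})"; cases c; cases "p a") simp_all
    qed
    then show ?thesis using S(1) unfolding simple_def affine_def by blast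
  next
    case 2
    then obtain S where S: "S \<subseteq> {..<n}" "S \<noteq> {}" "\<And>a. (\<not> p (\<lambda>i. \<not> a i)) = (\<forall>i\<in>S. a i)"
      unfolding conjunctive_def by blast
    have "p a = (\<exists>i\<in>S. a i)" for a using S(3)[of "\<lambda>i. \<not> a i"] by auto
    then show ?thesis using S(1,2) unfolding simple_def disjunctive_def by blast
  next
    case 3
    then obtain S where S: "S \<subseteq> {..<n}" "S \<noteq> {}" "\<And>a. (\<not> p (\<lambda>i. \<not> a i)) = (\<exists>i\<in>S. a i)"
      unfolding disjunctive_def by blast
    have "p a = (\<forall>i\<in>S. a i)" for a using S(3)[of "\<lambda>i. \<not> a i"] by auto
    then show ?thesis using S(1,2) unfolding simple_def conjunctive_def by blast
  qed
qed

lemma affine_const: "affine n (\<lambda>_. c)"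
  unfolding affine_def by (intro exI[of _ "{}"] exI[of _ c] conjI) auto

lemma (in assoc_fn) zero_case_simple:
  assumes "\<not> f (replicate n False)"
  shows "simple n (\<lambda>a. f (map a [0..<n]))"
proof -
  have len: "length (map a [0..<n]) = n" for a by simp
  from zero_case[OF assms] show ?thesis
  proof (elim disjE exE)
    assume *: "\<forall>xs. length xs = n \<longrightarrow> f xs = odd (ones xs)"
    have "f (map a [0..<n]) = (False \<noteq> odd (card {i\<in>{..<n}. a i}))" for a
      by (simp only: *[rule_format, OF len] card_filter_map simp_thms)
    then show ?thesis unfolding simple_def affine_def by blast
  next
    assume "\<forall>xs. length xs = n \<longrightarrow> f xs = (\<exists>x\<in>set xs. x)"
    then have "f (map a [0..<n]) = (\<exists>i\<in>{..<n}. a i)" for a by (auto simp: lessThan_atLeast0)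
    moreover have "0 \<in> {..<n}" using n2 by simp
    then have "{..<n} \<noteq> {}" by blast
    ultimately show ?thesis unfolding simple_def disjunctive_def by blast
  next
    assume "\<forall>xs. length xs = n \<longrightarrow> f xs = hd xs"
    then have "f (map a [0..<n]) = (\<forall>i\<in>{0}. a i)" for a using n2 by (simp add: hd_map)
    moreover have "{0} \<subseteq> {..<n}" using n2 by auto
    ultimately show ?thesis unfolding simple_def conjunctive_def by blast
  next
    assume "\<forall>xs. length xs = n \<longrightarrow> f xs = last xs"
    then have "f (map a [0..<n]) = (\<forall>i\<in>{n - 1}. a i)" for a using n2 by (simp add: last_map)
    moreover have "{n - 1} \<subseteq> {..<n}" using n2 by auto
    ultimately show ?thesis unfolding simple_def conjunctive_def by blast
  next
    fix c assume *: "\<forall>xs. length xs = n \<longrightarrow> f xs = (c \<and> (\<forall>x\<in>set xs. x))"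
    show ?thesis
    proof (cases c)
      case True
      then have "f (map a [0..<n]) = (\<forall>i\<in>{..<n}. a i)" for a using * by (auto simp: lessThan_atLeast0)
      moreover have "0 \<in> {..<n}" using n2 by simp
    then have "{..<n} \<noteq> {}" by blast
      ultimately show ?thesis unfolding simple_def conjunctive_def by blast
    next
      case False
      with * show ?thesis by (simp add: simple_def affine_const)
    qed
  qed
qed

lemma associative_dual:
  assumes "associative (n, f)" "n \<ge> 1"
  shows "associative (n, \<lambda>xs. \<not> f (map Not xs))"
proof -
  have "inner_applied_at n (\<lambda>xs. \<not> f (map Not xs)) i xs = (\<not> inner_applied_at n f i (map Not xs))" for i xs
    by (simp add: inner_applied_at_def take_map drop_map)
  moreover have "map Not xs \<in> vecs m" if "xs \<in> vecs m" for xs m using that by (simp add: vecs_def)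
  ultimately show ?thesis using assms(1) by (auto simp: associative_def)
qed

text \<open>All unary functions are associative and also affine. For larger arity the value at the
  constant False may be made False by passing to the dual, unless \<open>f\<close> is True there and
  False at the constant True; that is \<open>parity_case\<close>.\<close>

lemma associative_simple:
  assumes "associative (n, f)" "n \<ge> 1"
  shows "simple n (\<lambda>a. f (map a [0..<n]))"
proof (cases "n = 1")
  case True
  have eq: "f (map a [0..<n]) = f [a 0]" for a using True by simp
  show ?thesis
  proof (cases "f [False] = f [True]")
    case c: True
    have "f [x] = f [True]" for x by (cases x) (use c in auto)
    then have "(\<lambda>a. f (map a [0..<n])) = (\<lambda>_. f [True])" unfolding eq by blast
    then show ?thesis by (simp only: simple_def affine_const simp_thms)
  next
    case False
    have "f (map a [0..<n]) = (f [False] \<noteq> odd (card {i\<in>{0}. a i}))" for a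
    proof -
      have "{i\<in>{0}. a i} = (if a 0 then {0} else {})" by auto
      then have "odd (card {i\<in>{0}. a i}) = a 0" by (simp only:) simp
      then show ?thesis unfolding eq using False by (cases "a 0") auto
    qed
    moreover have "{0} \<subseteq> {..<n}" using True by auto
    ultimately show ?thesis unfolding simple_def affine_def by blast
  qed
next
  case False
  then have n2: "n \<ge> 2" using assms(2) by simp
  interpret assoc_fn n f by unfold_locales (use assms n2 in auto)
  show ?thesis
  proof (cases "f (replicate n False)")
    case False
    then show ?thesis by (rule zero_case_simple)
  next
    case D0: True
    show ?thesis
    proof (cases "f (replicate n True)")
      case True
      interpret dual: assoc_fn n "\<lambda>xs. \<not> f (map Not xs)"
        by unfold_locales (use associative_dual[OF assms] n2 in auto)
      have "simple n (\<lambda>a. \<not> f (map Not (map a [0..<n])))"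
        by (rule dual.zero_case_simple) (use True in simp)
      then have "simple n (\<lambda>a. \<not> (\<lambda>a. f (map a [0..<n])) (\<lambda>i. \<not> a i))" by (simp add: comp_def)
      then show ?thesis by (rule simple_dual)
    next
      case False
      then obtain c where c: "\<forall>xs. length xs = n \<longrightarrow> f xs = (c \<noteq> odd (length (filter (\<lambda>x. x) xs)))"
        using parity_case D0 by blast
      have len: "length (map a [0..<n]) = n" for a by simp
      have "f (map a [0..<n]) = (c \<noteq> odd (card {i\<in>{..<n}. a i}))" for a
        by (simp only: c[rule_format, OF len] card_filter_map)
      then show ?thesis unfolding simple_def affine_def by blast
    qed
  qed
qed

section \<open>Minors and normal forms of the simple functions\<close>

lemma affine_minor:
  assumes "affine n q" "\<And>i. i < n \<Longrightarrow> \<sigma> i < m"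
  shows "affine m (\<lambda>a. q (\<lambda>i. a (\<sigma> i)))"
proof -
  obtain S c where S: "S \<subseteq> {..<n}" "\<And>a. q a = (c \<noteq> odd (card {i\<in>S. a i}))"
    using assms(1) unfolding affine_def by blast
  \<comment> \<open>Variables that are hit an even number of times cancel.\<close>
  define S' where "S' = {t\<in>{..<m}. odd (card {i\<in>S. \<sigma> i = t})}"
  have fin: "finite S" using S(1) finite_subset by blast
  have "odd (card {i\<in>S. a (\<sigma> i)}) = odd (card {t\<in>S'. a t})" for a
  proof -
    have "card {i\<in>S. a (\<sigma> i)} = (\<Sum>t\<in>{t\<in>{..<m}. a t}. card {i\<in>{i\<in>S. a (\<sigma> i)}. \<sigma> i = t})"
      unfolding card_eq_sum by (rule sum.group[symmetric]) (use fin S(1) assms(2) in auto)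
    also have "\<dots> = (\<Sum>t\<in>{t\<in>{..<m}. a t}. card {i\<in>S. \<sigma> i = t})"
      by (intro sum.cong arg_cong[where f = card]) auto
    finally have "odd (card {i\<in>S. a (\<sigma> i)}) =
        odd (card {t\<in>{t\<in>{..<m}. a t}. odd (card {i\<in>S. \<sigma> i = t})})"
      by (simp add: even_sum_iff)
    moreover have "{t\<in>{t\<in>{..<m}. a t}. odd (card {i\<in>S. \<sigma> i = t})} = {t\<in>S'. a t}"
      by (auto simp: S'_def)
    ultimately show ?thesis by simp
  qed
  then have "q (\<lambda>i. a (\<sigma> i)) = (c \<noteq> odd (card {t\<in>S'. a t}))" for a by (simp add: S(2))
  moreover have "S' \<subseteq> {..<m}" by (auto simp: S'_def)
  ultimately show ?thesis unfolding affine_def by blast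
qed

lemma conjunctive_minor:
  assumes "conjunctive n q" "\<And>i. i < n \<Longrightarrow> \<sigma> i < m"
  shows "conjunctive m (\<lambda>a. q (\<lambda>i. a (\<sigma> i)))"
proof -
  obtain S where S: "S \<subseteq> {..<n}" "S \<noteq> {}" "\<And>a. q a = (\<forall>i\<in>S. a i)"
    using assms(1) unfolding conjunctive_def by blast
  have "\<sigma> ` S \<subseteq> {..<m}" "\<sigma> ` S \<noteq> {}" using S(1,2) assms(2) by auto
  moreover have "q (\<lambda>i. a (\<sigma> i)) = (\<forall>t\<in>\<sigma> ` S. a t)" for a by (simp add: S(3))
  ultimately show ?thesis unfolding conjunctive_def by blast
qed

lemma disjunctive_minor:
  assumes "disjunctive n q" "\<And>i. i < n \<Longrightarrow> \<sigma> i < m"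
  shows "disjunctive m (\<lambda>a. q (\<lambda>i. a (\<sigma> i)))"
proof -
  obtain S where S: "S \<subseteq> {..<n}" "S \<noteq> {}" "\<And>a. q a = (\<exists>i\<in>S. a i)"
    using assms(1) unfolding disjunctive_def by blast
  have "\<sigma> ` S \<subseteq> {..<m}" "\<sigma> ` S \<noteq> {}" using S(1,2) assms(2) by auto
  moreover have "q (\<lambda>i. a (\<sigma> i)) = (\<exists>t\<in>\<sigma> ` S. a t)" for a by (simp add: S(3))
  ultimately show ?thesis unfolding disjunctive_def by blast
qed

text \<open>Representatives up to mutual minors: only the kind of function, the number of its
  essential variables and, for affine functions, the constant \<open>c\<close> matter.\<close>

definition parity_fn :: "bool \<Rightarrow> nat \<Rightarrow> bfn" where
  "parity_fn c k = (\<lambda>a. c \<noteq> odd (card {i\<in>{..<k}. a i}))"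

definition and_fn :: "nat \<Rightarrow> bfn" where
  "and_fn k = (\<lambda>a. \<forall>i<k. a i)"

definition or_fn :: "nat \<Rightarrow> bfn" where
  "or_fn k = (\<lambda>a. \<exists>i<k. a i)"

lemma depends_below_parity_fn: "k \<le> n \<Longrightarrow> depends_below n (parity_fn c k)"
  unfolding depends_below_def
proof (intro allI impI)
  fix a b :: "nat \<Rightarrow> bool" assume "k \<le> n" "\<forall>i<n. a i = b i"
  then have "{i\<in>{..<k}. a i} = {i\<in>{..<k}. b i}" by auto
  then show "parity_fn c k a = parity_fn c k b" by (simp only: parity_fn_def)
qed

lemma depends_below_and_fn: "depends_below k (and_fn k)"
  unfolding depends_below_def and_fn_def by simp

lemma depends_below_or_fn: "depends_below k (or_fn k)"
  unfolding depends_below_def or_fn_def by auto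

text \<open>If the nested value is a function of the whole word, it cannot see where the inner block
  sits. \<open>\<Phi>\<close> may differ from \<open>\<phi>\<close>: for complemented parity the
  inner and outer complements cancel.\<close>

lemma associativeI:
  assumes "n \<ge> 1" "\<And>xs. length xs = n \<Longrightarrow> f xs = \<phi> xs"
    and "\<And>u b v. \<phi> (u @ \<phi> b # v) = \<Phi> (u @ b @ v)"
  shows "associative (n, f)"
proof -
  have "inner_applied_at n f i xs = \<Phi> xs" if "i < n" "length xs = 2 * n - 1" for i xs
  proof -
    have "f (take n (drop i xs)) = \<phi> (take n (drop i xs))"
      by (rule assms(2)) (use that in simp)
    moreover have "f (take i xs @ y # drop (i + n) xs) = \<phi> (take i xs @ y # drop (i + n) xs)" for y
      by (rule assms(2)) (use that in simp)
    moreover have "take i xs @ take n (drop i xs) @ drop (i + n) xs = xs"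
      by (metis append_take_drop_id drop_drop add.commute)
    ultimately show ?thesis by (simp add: inner_applied_at_def assms(3))
  qed
  then show ?thesis by (auto simp: associative_def vecs_def)
qed

lemma map_nth_upt: "length xs = n \<Longrightarrow> map ((!) xs) [0..<n] = xs"
  by (auto simp: map_nth)

lemma associative_parity_fn:
  assumes "n \<ge> 1"
  shows "associative (emb n (parity_fn c n))"
  unfolding emb_def
proof (rule associativeI)
  fix xs :: "bool list" assume len: "length xs = n"
  have "card {i\<in>{..<n}. xs ! i} = length (filter (\<lambda>x. x) xs)"
    using card_filter_map[of "(!) xs" n] by (simp only: map_nth_upt[OF len])
  then show "(\<lambda>v\<in>vecs n. parity_fn c n ((!) v)) xs = (c \<noteq> odd (length (filter (\<lambda>x. x) xs)))"
    using len by (simp only: parity_fn_def vecs_def restrict_def mem_Collect_eq if_True refl)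
next
  fix u b v
  show "(c \<noteq> odd (length (filter (\<lambda>x. x) (u @ (c \<noteq> odd (length (filter (\<lambda>x. x) b))) # v)))) =
      odd (length (filter (\<lambda>x. x) (u @ b @ v)))"
    by (cases c) auto
qed (rule assms)

lemma associative_and_fn:
  assumes "n \<ge> 1"
  shows "associative (emb n (and_fn n))"
  unfolding emb_def
proof (rule associativeI)
  fix xs :: "bool list" assume len: "length xs = n"
  have "(\<forall>x\<in>set xs. x) = (\<forall>i<n. xs ! i)" using len by (simp add: all_set_conv_all_nth)
  then show "(\<lambda>v\<in>vecs n. and_fn n ((!) v)) xs = (\<forall>x\<in>set xs. x)"
    using len by (simp add: and_fn_def vecs_def)
next
  fix u b v
  show "(\<forall>x\<in>set (u @ (\<forall>x\<in>set b. x) # v). x) = (\<forall>x\<in>set (u @ b @ v). x)" by auto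
qed (rule assms)

lemma associative_or_fn:
  assumes "n \<ge> 1"
  shows "associative (emb n (or_fn n))"
  unfolding emb_def
proof (rule associativeI)
  fix xs :: "bool list" assume len: "length xs = n"
  have "(\<exists>x\<in>set xs. x) = (\<exists>i<n. xs ! i)" using len by (metis in_set_conv_nth)
  then show "(\<lambda>v\<in>vecs n. or_fn n ((!) v)) xs = (\<exists>x\<in>set xs. x)"
    using len by (simp add: or_fn_def vecs_def)
next
  fix u b v
  show "(\<exists>x\<in>set (u @ (\<exists>x\<in>set b. x) # v). x) = (\<exists>x\<in>set (u @ b @ v). x)" by auto
qed (rule assms)

lemma card_bij_betw_filter:
  assumes "bij_betw h A B"
  shows "card {i\<in>A. a (h i)} = card {i\<in>B. a i}"
proof -
  have "card {i\<in>A. a (h i)} = card (h ` {i\<in>A. a (h i)})"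
    by (rule card_image[symmetric]) (use assms in \<open>auto simp: bij_betw_def inj_on_def\<close>)
  also have "h ` {i\<in>A. a (h i)} = {i\<in>B. a i}" using assms by (auto simp: bij_betw_def)
  finally show ?thesis .
qed

text \<open>The additional variable \<open>k\<close> of \<open>emb (k + 1) (parity_fn c k)\<close> is inessential: it covers
  the case \<open>k = 0\<close>, and it receives pairs of identified variables, which cancel.\<close>

lemma parity_step:
  assumes "k + 2 \<le> m"
  shows "emb (k + 1) (parity_fn c k) \<preceq>\<^sub>V emb m (parity_fn c (k + 2))"
proof -
  have "parity_fn c k a = parity_fn c (k + 2) (\<lambda>i. a (min i k))" for a
  proof -
    have "{i\<in>{..<k + 2}. a (min i k)} = {i\<in>{..<k}. a i} \<union> (if a k then {k, k + 1} else {})"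
      by (auto simp: min_def less_Suc_eq)
    then have "card {i\<in>{..<k + 2}. a (min i k)} =
        card ({i\<in>{..<k}. a i} \<union> (if a k then {k, k + 1} else {}))" by (rule arg_cong)
    also have "\<dots> = card {i\<in>{..<k}. a i} + card (if a k then {k, k + 1} else {})"
      by (rule card_Un_disjoint) auto
    finally show ?thesis by (simp add: parity_fn_def)
  qed
  then show ?thesis using depends_below_parity_fn[OF assms]
    by (intro emb_minorI[where \<sigma> = "\<lambda>i. min i k"]) auto
qed

lemma affine_minor_parity:
  assumes "n \<ge> 1" "S \<subseteq> {..<n}" "card S = k" "p = (\<lambda>a. c \<noteq> odd (card {i\<in>S. a i}))"
    and dep: "depends_below n p"
  shows "emb n p \<preceq>\<^sub>V emb (k + 1) (parity_fn c k)" "emb (k + 1) (parity_fn c k) \<preceq>\<^sub>V emb n p"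
proof -
  have fin: "finite S" using assms(2) finite_subset by blast
  obtain h where h: "bij_betw h {..<k} S"
    using ex_bij_betw_nat_finite[OF fin] assms(3) by (auto simp: lessThan_atLeast0)
  define g where "g = the_inv_into {..<k} h"
  have g: "bij_betw g S {..<k}" unfolding g_def by (rule bij_betw_the_inv_into[OF h])
  show "emb n p \<preceq>\<^sub>V emb (k + 1) (parity_fn c k)"
  proof (rule emb_minorI[where \<sigma> = "\<lambda>i. if i < k then h i else 0"])
    show "depends_below (k + 1) (parity_fn c k)" by (rule depends_below_parity_fn) simp
    show "(if i < k then h i else 0) < n" for i
      using h assms(1,2) by (auto simp: bij_betw_def)
    have "{i\<in>{..<k}. a (if i < k then h i else 0)} = {i\<in>{..<k}. a (h i)}" for a by auto
    then show "p = (\<lambda>a. parity_fn c k (\<lambda>i. a (if i < k then h i else 0)))"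
      by (simp only: assms(4) parity_fn_def card_bij_betw_filter[OF h])
  qed
  \<comment> \<open>Indices outside \<open>S\<close> are inessential for \<open>p\<close> and are
    sent to the spare variable \<open>k\<close>.\<close>
  show "emb (k + 1) (parity_fn c k) \<preceq>\<^sub>V emb n p"
  proof (rule emb_minorI[OF dep, where \<sigma> = "\<lambda>i. if i \<in> S then g i else k"])
    show "(if i \<in> S then g i else k) < k + 1" for i
      using bij_betwE[OF g] by (auto simp: less_Suc_eq)
    have "{i\<in>S. a (if i \<in> S then g i else k)} = {i\<in>S. a (g i)}" for a by auto
    then show "parity_fn c k = (\<lambda>a. p (\<lambda>i. a (if i \<in> S then g i else k)))"
      by (simp only: assms(4) parity_fn_def card_bij_betw_filter[OF g])
  qed
qed

lemma conjunctive_minor_and: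
  assumes "S \<subseteq> {..<n}" "S \<noteq> {}" "card S = k" "p = (\<lambda>a. \<forall>i\<in>S. a i)"
    and dep: "depends_below n p"
  shows "emb n p \<preceq>\<^sub>V emb k (and_fn k)" "emb k (and_fn k) \<preceq>\<^sub>V emb n p"
proof -
  have fin: "finite S" using assms(1) finite_subset by blast
  obtain h where h: "bij_betw h {..<k} S"
    using ex_bij_betw_nat_finite[OF fin] assms(3) by (auto simp: lessThan_atLeast0)
  define g where "g = the_inv_into {..<k} h"
  have g: "bij_betw g S {..<k}" unfolding g_def by (rule bij_betw_the_inv_into[OF h])
  have k: "k > 0" using fin assms(2,3) by (auto simp: card_gt_0_iff)
  have S: "S = h ` {..<k}" "{..<k} = g ` S" using h g by (simp_all add: bij_betw_def)
  have "p = (\<lambda>a. and_fn k (\<lambda>i. a (h i)))" by (auto simp: assms(4) and_fn_def S(1))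
  moreover have "h i < n" if "i < k" for i using that assms(1) bij_betwE[OF h] by auto
  ultimately show "emb n p \<preceq>\<^sub>V emb k (and_fn k)"
    using depends_below_and_fn by (intro emb_minorI) auto
  have "(\<forall>i<k. a i) = (\<forall>i\<in>S. a (g i))" for a
  proof -
    have "(\<forall>i<k. a i) = (\<forall>j\<in>g ` S. a j)" unfolding S(2)[symmetric] by auto
    then show ?thesis by simp
  qed
  then have "and_fn k = (\<lambda>a. p (\<lambda>i. a (if i \<in> S then g i else 0)))"
    by (auto simp: assms(4) and_fn_def)
  moreover have "(if i \<in> S then g i else 0) < k" for i using bij_betwE[OF g] k by auto
  ultimately show "emb k (and_fn k) \<preceq>\<^sub>V emb n p"
    by (intro emb_minorI[OF dep, where \<sigma> = "\<lambda>i. if i \<in> S then g i else 0"]) auto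
qed

lemma disjunctive_minor_or:
  assumes "S \<subseteq> {..<n}" "S \<noteq> {}" "card S = k" "p = (\<lambda>a. \<exists>i\<in>S. a i)"
    and dep: "depends_below n p"
  shows "emb n p \<preceq>\<^sub>V emb k (or_fn k)" "emb k (or_fn k) \<preceq>\<^sub>V emb n p"
proof -
  have fin: "finite S" using assms(1) finite_subset by blast
  obtain h where h: "bij_betw h {..<k} S"
    using ex_bij_betw_nat_finite[OF fin] assms(3) by (auto simp: lessThan_atLeast0)
  define g where "g = the_inv_into {..<k} h"
  have g: "bij_betw g S {..<k}" unfolding g_def by (rule bij_betw_the_inv_into[OF h])
  have k: "k > 0" using fin assms(2,3) by (auto simp: card_gt_0_iff)
  have S: "S = h ` {..<k}" "{..<k} = g ` S" using h g by (simp_all add: bij_betw_def)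
  have "p = (\<lambda>a. or_fn k (\<lambda>i. a (h i)))" by (auto simp: assms(4) or_fn_def S(1))
  moreover have "h i < n" if "i < k" for i using that assms(1) bij_betwE[OF h] by auto
  ultimately show "emb n p \<preceq>\<^sub>V emb k (or_fn k)"
    using depends_below_or_fn by (intro emb_minorI) auto
  have "(\<exists>i<k. a i) = (\<exists>i\<in>S. a (g i))" for a
  proof -
    have "(\<exists>i<k. a i) = (\<exists>j\<in>g ` S. a j)" unfolding S(2)[symmetric] by auto
    then show ?thesis by simp
  qed
  then have "or_fn k = (\<lambda>a. p (\<lambda>i. a (if i \<in> S then g i else 0)))"
    by (auto simp: assms(4) or_fn_def)
  moreover have "(if i \<in> S then g i else 0) < k" for i using bij_betwE[OF g] k by auto
  ultimately show "emb k (or_fn k) \<preceq>\<^sub>V emb n p"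
    by (intro emb_minorI[OF dep, where \<sigma> = "\<lambda>i. if i \<in> S then g i else 0"]) auto
qed

lemma quasi_associative_iff:
  assumes "n \<ge> 1" "depends_below n p"
  shows "quasi_associative (emb n p) \<longleftrightarrow> simple n p"
proof
  assume "quasi_associative (emb n p)"
  then obtain F where F: "F \<in> bool_functions" "associative F" "emb n p \<preceq>\<^sub>V F"
    unfolding quasi_associative_def by blast
  obtain m q where q: "m \<ge> 1" "depends_below m q" "F = emb m q"
    using F(1) by (elim bool_functions_emb)
  have "simple m (\<lambda>a. snd F (map a [0..<m]))"
  proof (rule associative_simple)
    show "associative (m, snd F)" using F(2) q(3) by (simp only: emb_def snd_conv)
  qed (rule q(1))
  moreover have "snd F (map a [0..<m]) = q a" for a
  proof -
    have "q ((!) (map a [0..<m])) = q a" by (rule depends_belowD[OF q(2)]) simp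
    then show ?thesis by (simp add: q(3) emb_list)
  qed
  ultimately have "simple m q" by simp
  moreover obtain \<sigma> where "\<And>i. i < m \<Longrightarrow> \<sigma> i < n" "p = (\<lambda>a. q (\<lambda>i. a (\<sigma> i)))"
    using emb_minorD[OF assms(2) q(2)] F(3) q(3) by blast
  ultimately show "simple n p"
    unfolding simple_def using affine_minor conjunctive_minor disjunctive_minor by metis
next
  have quasi: "quasi_associative (emb n p)"
    if "m \<ge> 1" "associative (emb m q)" "emb n p \<preceq>\<^sub>V emb m q" for m q
    using that emb_in_bool_functions unfolding quasi_associative_def by blast
  assume "simple n p"
  then consider "affine n p" | "conjunctive n p" | "disjunctive n p" unfolding simple_def by blast
  then show "quasi_associative (emb n p)"
  proof cases
    case 1
    then obtain S c where S: "S \<subseteq> {..<n}" "p = (\<lambda>a. c \<noteq> odd (card {i\<in>S. a i}))"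
      unfolding affine_def by blast
    let ?k = "card S"
    show ?thesis
    proof (rule quasi)
      \<comment> \<open>The arity has to be positive even for empty \<open>S\<close>. Two further
        variables, identified with each other, leave the parity unchanged.\<close>
      show "associative (emb (?k + 2) (parity_fn c (?k + 2)))" by (rule associative_parity_fn) simp
      show "emb n p \<preceq>\<^sub>V emb (?k + 2) (parity_fn c (?k + 2))"
      proof (rule minor_trans)
        show "emb n p \<preceq>\<^sub>V emb (?k + 1) (parity_fn c ?k)"
          by (rule affine_minor_parity(1)[OF assms(1) S(1) refl S(2) assms(2)])
        show "emb (?k + 1) (parity_fn c ?k) \<preceq>\<^sub>V emb (?k + 2) (parity_fn c (?k + 2))"
          by (rule parity_step) simp
      qed (rule emb_in_bool_functions; use assms(1) in simp)+
    qed simp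
  next
    case 2
    then obtain S where S: "S \<subseteq> {..<n}" "S \<noteq> {}" "\<And>a. p a = (\<forall>i\<in>S. a i)"
      unfolding conjunctive_def by blast
    from S(3) have p: "p = (\<lambda>a. \<forall>i\<in>S. a i)" by (rule ext)
    have "card S \<ge> 1"
      using S(1,2) finite_subset[of S "{..<n}"] by (simp add: Suc_le_eq card_gt_0_iff)
    then show ?thesis
      using conjunctive_minor_and(1)[OF S(1,2) refl p assms(2)] associative_and_fn
      by (intro quasi[of "card S" "and_fn (card S)"])
  next
    case 3
    then obtain S where S: "S \<subseteq> {..<n}" "S \<noteq> {}" "\<And>a. p a = (\<exists>i\<in>S. a i)"
      unfolding disjunctive_def by blast
    from S(3) have p: "p = (\<lambda>a. \<exists>i\<in>S. a i)" by (rule ext)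
    have "card S \<ge> 1"
      using S(1,2) finite_subset[of S "{..<n}"] by (simp add: Suc_le_eq card_gt_0_iff)
    then show ?thesis
      using disjunctive_minor_or(1)[OF S(1,2) refl p assms(2)] associative_or_fn
      by (intro quasi[of "card S" "or_fn (card S)"])
  qed
qed

section \<open>Countable intervals\<close>

lemma countable_downsets: "countable {D :: nat set. \<forall>k\<in>D. \<forall>j\<le>k. j \<in> D}"
proof (rule countable_subset)
  show "{D :: nat set. \<forall>k\<in>D. \<forall>j\<le>k. j \<in> D} \<subseteq> insert UNIV (range lessThan)"
  proof
    fix D :: "nat set" assume "D \<in> {D. \<forall>k\<in>D. \<forall>j\<le>k. j \<in> D}"
    then have D: "\<And>j k. k \<in> D \<Longrightarrow> j \<le> k \<Longrightarrow> j \<in> D" by blast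
    show "D \<in> insert UNIV (range lessThan)"
    proof (cases "D = UNIV")
      case False
      define m where "m = (LEAST m. m \<notin> D)"
      have "m \<notin> D" unfolding m_def using False by (metis LeastI UNIV_eq_I)
      moreover have "j \<in> D" if "j < m" for j using not_less_Least that unfolding m_def by blast
      ultimately have "D = {..<m}" using D by (meson equalityI lessThan_iff not_le subsetI)
      then show ?thesis by blast
    qed simp
  qed
qed simp

lemma countable_interval:
  fixes chain :: "nat \<Rightarrow> nat \<Rightarrow> bfun"
  assumes chain_fun: "\<And>t k. t < N \<Longrightarrow> chain t k \<in> bool_functions"
    and chain_le: "\<And>t k. t < N \<Longrightarrow> chain t k \<preceq>\<^sub>V chain t (Suc k)"
    and cover: "\<And>G. G \<in> C2 - C1 \<Longrightarrow> G \<in> bool_functions \<and>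
      (\<exists>t<N. \<exists>k. G \<preceq>\<^sub>V chain t k \<and> chain t k \<preceq>\<^sub>V G)"
  shows "countable (class_interval C1 C2)"
proof -
  \<comment> \<open>The recorded chain members need not lie in \<open>C2 - C1\<close>; it is enough
    that each function in that difference has a recorded equivalent.\<close>
  define code where "code K = map (\<lambda>t. {k. chain t k \<in> K}) [0..<N]" for K
  define \<D> where "\<D> = {D :: nat set. \<forall>k\<in>D. \<forall>j\<le>k. j \<in> D}"
  have down: "G \<in> K" if "equational_class K" "F \<in> K" "G \<in> bool_functions" "G \<preceq>\<^sub>V F" for F G K
    using that by (auto simp: equational_class_def)
  have "code K \<in> lists \<D>" if K: "K \<in> class_interval C1 C2" for K
  proof -
    have "chain t j \<in> K" if "t < N" "chain t k \<in> K" "j \<le> k" for t j k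
      using that(3,2)
    proof (induction rule: inc_induct)
      case (step j)
      then show ?case
        using down[of K "chain t (Suc j)" "chain t j"] chain_fun chain_le that(1) K
        by (auto simp: class_interval_def)
    qed
    then show ?thesis by (auto simp: code_def \<D>_def)
  qed
  then have "code ` class_interval C1 C2 \<subseteq> lists \<D>" by blast
  moreover have "countable (lists \<D>)"
    unfolding \<D>_def by (rule countable_lists[OF countable_downsets])
  ultimately have "countable (code ` class_interval C1 C2)" by (rule countable_subset)
  moreover have "inj_on code (class_interval C1 C2)"
  proof (rule inj_onI)
    have sub: "K \<subseteq> K'"
      if K: "K \<in> class_interval C1 C2" "K' \<in> class_interval C1 C2" "code K = code K'" for K K'
    proof
      fix G assume G: "G \<in> K"
      show "G \<in> K'"
      proof (cases "G \<in> C1")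
        case True
        then show ?thesis using K(2) by (auto simp: class_interval_def)
      next
        case False
        then have "G \<in> C2 - C1" using G K(1) by (auto simp: class_interval_def)
        then obtain t k where t: "G \<in> bool_functions" "t < N" "G \<preceq>\<^sub>V chain t k" "chain t k \<preceq>\<^sub>V G"
          using cover by blast
        have "chain t k \<in> K"
          using down[of K G] G t chain_fun K(1) by (auto simp: class_interval_def)
        then have "chain t k \<in> K'"
          using K(3) t(2) by (auto simp: code_def)
        then show ?thesis using down[of K' "chain t k" G] t K(2) by (auto simp: class_interval_def)
      qed
    qed
    show "K = K'" if "K \<in> class_interval C1 C2" "K' \<in> class_interval C1 C2" "code K = code K'" for K K'
      using sub[of K K'] sub[of K' K] that by simp
  qed
  ultimately show ?thesis by (rule countable_image_inj_on)
qed

text \<open>Identifying variables of an affine function keeps \<open>c\<close> and lowers the number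
  of essential variables by an even number, so there are four affine chains: \<open>t < 4\<close>
  encodes \<open>c\<close>, and \<open>t mod 2\<close> the parity of that number.\<close>

definition simple_chain :: "nat \<Rightarrow> nat \<Rightarrow> bfun" where
  "simple_chain t k =
     (if t = 0 then emb (Suc k) (and_fn (Suc k))
      else if t = 1 then emb (Suc k) (or_fn (Suc k))
      else emb (2 * k + t mod 2 + 1) (parity_fn (t < 4) (2 * k + t mod 2)))"

lemma simple_chain_cover:
  assumes "n \<ge> 1" "depends_below n p" "simple n p"
  shows "\<exists>t<6. \<exists>k. emb n p \<preceq>\<^sub>V simple_chain t k \<and> simple_chain t k \<preceq>\<^sub>V emb n p"
proof -
  from assms(3) consider "affine n p" | "conjunctive n p" | "disjunctive n p"
    unfolding simple_def by blast
  then show ?thesis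
  proof cases
    case 1
    then obtain S c where S: "S \<subseteq> {..<n}" "p = (\<lambda>a. c \<noteq> odd (card {i\<in>S. a i}))"
      unfolding affine_def by blast
    define t where "t = card S mod 2 + (if c then 2 else 4)"
    have "t mod 2 = card S mod 2" unfolding t_def by (cases c; simp; presburger)
    then have "2 * (card S div 2) + t mod 2 = card S" by simp
    moreover have "(t < 4) = c" "t < 6" "t \<noteq> 0" "t \<noteq> 1" unfolding t_def by (cases c; simp; presburger)+
    ultimately have "simple_chain t (card S div 2) = emb (card S + 1) (parity_fn c (card S))"
      by (simp add: simple_chain_def)
    with affine_minor_parity[OF assms(1) S(1) refl S(2) assms(2)] \<open>t < 6\<close>
    show ?thesis by metis
  next
    case 2
    then obtain S where S: "S \<subseteq> {..<n}" "S \<noteq> {}" "\<And>a. p a = (\<forall>i\<in>S. a i)"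
      unfolding conjunctive_def by blast
    from S(3) have p: "p = (\<lambda>a. \<forall>i\<in>S. a i)" by (rule ext)
    obtain k where k: "card S = Suc k"
      using S(1,2) finite_subset[of S "{..<n}"] by (metis card_eq_0_iff finite_lessThan not0_implies_Suc)
    show ?thesis
      using conjunctive_minor_and[OF S(1,2) k p assms(2)]
      by (intro exI[of _ 0] exI[of _ k] conjI) (simp_all add: simple_chain_def)
  next
    case 3
    then obtain S where S: "S \<subseteq> {..<n}" "S \<noteq> {}" "\<And>a. p a = (\<exists>i\<in>S. a i)"
      unfolding disjunctive_def by blast
    from S(3) have p: "p = (\<lambda>a. \<exists>i\<in>S. a i)" by (rule ext)
    obtain k where k: "card S = Suc k"
      using S(1,2) finite_subset[of S "{..<n}"] by (metis card_eq_0_iff finite_lessThan not0_implies_Suc)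
    show ?thesis
      using disjunctive_minor_or[OF S(1,2) k p assms(2)]
      by (intro exI[of _ 1] exI[of _ k] conjI) (simp_all add: simple_chain_def)
  qed
qed

lemma simple_chain_le: "simple_chain t k \<preceq>\<^sub>V simple_chain t (Suc k)"
proof -
  have img: "(\<lambda>i. min i k) ` {..<Suc (Suc k)} = {..<Suc k}"
  proof (intro equalityI subsetI)
    fix i assume "i \<in> {..<Suc k}"
    then have "i = min i k" "i \<in> {..<Suc (Suc k)}" by auto
    then show "i \<in> (\<lambda>i. min i k) ` {..<Suc (Suc k)}" by (rule image_eqI)
  qed auto
  have "emb (Suc k) (and_fn (Suc k)) \<preceq>\<^sub>V emb (Suc (Suc k)) (and_fn (Suc (Suc k)))"
  proof (rule emb_minorI[OF depends_below_and_fn, where \<sigma> = "\<lambda>i. min i k"])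
    have "(\<forall>i\<in>{..<Suc k}. a i) = (\<forall>i\<in>{..<Suc (Suc k)}. a (min i k))" for a
      unfolding img[symmetric] by blast
    then show "and_fn (Suc k) = (\<lambda>a. and_fn (Suc (Suc k)) (\<lambda>i. a (min i k)))"
      unfolding and_fn_def Ball_def lessThan_iff by (rule ext)
  qed simp
  moreover have "emb (Suc k) (or_fn (Suc k)) \<preceq>\<^sub>V emb (Suc (Suc k)) (or_fn (Suc (Suc k)))"
  proof (rule emb_minorI[OF depends_below_or_fn, where \<sigma> = "\<lambda>i. min i k"])
    have "(\<exists>i\<in>{..<Suc k}. a i) = (\<exists>i\<in>{..<Suc (Suc k)}. a (min i k))" for a
      unfolding img[symmetric] by blast
    then show "or_fn (Suc k) = (\<lambda>a. or_fn (Suc (Suc k)) (\<lambda>i. a (min i k)))"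
      unfolding or_fn_def Bex_def lessThan_iff by (rule ext)
  qed simp
  ultimately show ?thesis
    using parity_step[of "2 * k + t mod 2" "2 * Suc k + t mod 2 + 1" "t < 4"]
    by (simp add: simple_chain_def)
qed

lemma countable_interval_quasi_associative:
  assumes "equational_class C2" "\<And>G. G \<in> C2 - C1 \<Longrightarrow> quasi_associative G"
  shows "countable (class_interval C1 C2)"
proof (rule countable_interval[where N = 6 and chain = simple_chain])
  show "simple_chain t k \<in> bool_functions" for t k
    by (auto simp: simple_chain_def intro!: emb_in_bool_functions)
  show "simple_chain t k \<preceq>\<^sub>V simple_chain t (Suc k)" for t k by (rule simple_chain_le)
  fix G assume G: "G \<in> C2 - C1"
  then have "G \<in> bool_functions" using assms(1) by (auto simp: equational_class_def)
  moreover obtain n p where p: "n \<ge> 1" "depends_below n p" "G = emb n p"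
    using calculation by (elim bool_functions_emb)
  moreover have "simple n p" using assms(2)[OF G] quasi_associative_iff[OF p(1,2)] p(3) by simp
  ultimately show "G \<in> bool_functions \<and> (\<exists>t<6. \<exists>k. G \<preceq>\<^sub>V simple_chain t k \<and> simple_chain t k \<preceq>\<^sub>V G)"
    using simple_chain_cover by blast
qed

section \<open>Functions generated by a non-associative function\<close>

definition maj :: "bool \<Rightarrow> bool \<Rightarrow> bool \<Rightarrow> bool" where
  "maj x y z \<longleftrightarrow> x \<and> y \<or> x \<and> z \<or> y \<and> z"

lemma finite_points: "finite {a :: nat \<Rightarrow> bool. \<forall>i. a i \<longrightarrow> i < m}"
proof (rule finite_subset)
  show "{a :: nat \<Rightarrow> bool. \<forall>i. a i \<longrightarrow> i < m} \<subseteq> (\<lambda>A i. i \<in> A) ` Pow {..<m}"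
  proof
    fix a :: "nat \<Rightarrow> bool" assume "a \<in> {a. \<forall>i. a i \<longrightarrow> i < m}"
    then have "a = (\<lambda>i. i \<in> {i. a i})" "{i. a i} \<in> Pow {..<m}" by auto
    then show "a \<in> (\<lambda>A i. i \<in> A) ` Pow {..<m}" by (rule image_eqI)
  qed
qed simp

lemma monotone_fnD:
  assumes "monotone_fn f" "\<And>i. a i \<Longrightarrow> b i" "f a"
  shows "f b"
proof -
  have "(\<forall>i. a i \<longrightarrow> b i) \<longrightarrow> f a \<longrightarrow> f b"
    by (rule assms(1)[unfolded monotone_fn_def, THEN spec, THEN spec])
  then show ?thesis using assms(2,3) by blast
qed

text \<open>If \<open>f\<close> is True at both points but they share no true index, one lies below
  the complement of the other, against self-duality. If the values differ and no index witnesses it,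
  one point lies below the other, against monotonicity. Two False values are treated like two True
  ones.\<close>

lemma agree_on_pair:
  assumes "depends_below m f" "monotone_fn f" "self_dual f"
  shows "\<exists>i<m. s i = f s \<and> t i = f t"
proof (rule ccontr)
  assume neg: "\<not> (\<exists>i<m. s i = f s \<and> t i = f t)"
  have le: "f a \<Longrightarrow> f b" if "\<And>i. i < m \<Longrightarrow> a i \<Longrightarrow> b i" for a b
  proof -
    have "f a = f (\<lambda>i. i < m \<and> a i)" "f b = f (\<lambda>i. i < m \<and> b i)"
      by (rule depends_belowD[OF assms(1)], simp)+
    moreover have "f (\<lambda>i. i < m \<and> a i) \<Longrightarrow> f (\<lambda>i. i < m \<and> b i)"
      using that by (elim monotone_fnD[OF assms(2), rotated]) auto
    ultimately show "f a \<Longrightarrow> f b" by simp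
  qed
  have dual: "f (\<lambda>i. \<not> a i) = (\<not> f a)" for a using assms(3) by (simp add: self_dual_def)
  show False
  proof (cases "f s"; cases "f t")
    assume "f s" "f t"
    then show False using neg le[of s "\<lambda>i. \<not> t i"] dual[of t] by auto
  next
    assume "f s" "\<not> f t"
    then show False using neg le[of s t] by auto
  next
    assume "\<not> f s" "f t"
    then show False using neg le[of t s] by auto
  next
    assume "\<not> f s" "\<not> f t"
    then show False using neg le[of "\<lambda>i. \<not> s i" t] dual[of s] by auto
  qed
qed

text \<open>Baker-Pixley interpolation: by the majority operation it suffices to interpolate at two
  points, and there some projection does.\<close>

lemma self_dual_monotone_generated:
  assumes proj: "\<And>i. i < m \<Longrightarrow> (\<lambda>a. a i) \<in> S"
    and maj: "\<And>p q r. p \<in> S \<Longrightarrow> q \<in> S \<Longrightarrow> r \<in> S \<Longrightarrow> (\<lambda>a. maj (p a) (q a) (r a)) \<in> S"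
    and dep: "\<And>p. p \<in> S \<Longrightarrow> depends_below m p"
    and f: "depends_below m f" "monotone_fn f" "self_dual f"
  shows "f \<in> S"
proof -
  have interp: "\<exists>p\<in>S. \<forall>t\<in>T. p t = f t" if "finite T" for T
    using that
  proof (induction "card T" arbitrary: T rule: less_induct)
    case less
    consider s t where "T \<subseteq> {s, t}"
      | x y z where "x \<in> T" "y \<in> T" "z \<in> T" "x \<noteq> y" "x \<noteq> z" "y \<noteq> z"
      by (metis insertCI subsetI)
    then show ?case
    proof cases
      case (1 s t)
      obtain i where "i < m" "s i = f s" "t i = f t" using agree_on_pair[OF f] by blast
      then show ?thesis using 1 proj[of i] by (intro bexI[of _ "\<lambda>a. a i"]) auto
    next
      case (2 x y z)
      have ex: "\<exists>p\<in>S. \<forall>t\<in>T - {v}. p t = f t" if "v \<in> T" for v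
        using less.hyps[of "T - {v}"] less.prems that card_Diff1_less[of T v] by simp
      obtain p where p: "p \<in> S" "\<forall>t\<in>T - {x}. p t = f t" using ex[OF 2(1)] by (rule bexE)
      obtain q where q: "q \<in> S" "\<forall>t\<in>T - {y}. q t = f t" using ex[OF 2(2)] by (rule bexE)
      obtain r where r: "r \<in> S" "\<forall>t\<in>T - {z}. r t = f t" using ex[OF 2(3)] by (rule bexE)
      \<comment> \<open>Each interpolant is missing a different point, so at every \<open>t\<close>
        at most one of the three can be wrong.\<close>
      have "maj (p t) (q t) (r t) = f t" if "t \<in> T" for t
      proof -
        have "t \<noteq> x \<longrightarrow> p t = f t" "t \<noteq> y \<longrightarrow> q t = f t" "t \<noteq> z \<longrightarrow> r t = f t"
          using p(2) q(2) r(2) that by simp_all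
        moreover have "t \<noteq> x \<and> t \<noteq> y \<or> t \<noteq> x \<and> t \<noteq> z \<or> t \<noteq> y \<and> t \<noteq> z" using 2(4-6) by blast
        ultimately show ?thesis by (auto simp: maj_def)
      qed
      then show ?thesis using maj[OF p(1) q(1) r(1)] by (intro bexI) auto
    qed
  qed
  obtain p where p: "p \<in> S" "\<And>t. (\<forall>i. t i \<longrightarrow> i < m) \<Longrightarrow> p t = f t"
    using interp[OF finite_points[of m]] by auto
  have "p a = f a" for a
  proof -
    have "p a = p (\<lambda>i. i < m \<and> a i)" by (rule depends_belowD[OF dep[OF p(1)]]) simp
    also have "\<dots> = f (\<lambda>i. i < m \<and> a i)" by (rule p(2)) simp
    also have "\<dots> = f a" by (rule depends_belowD[OF f(1)]) simp
    finally show ?thesis .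
  qed
  then have "p = f" by (rule ext)
  then show ?thesis using p(1) by simp
qed

text \<open>The source of all binary operations below: a point \<open>a\<close> splits the variables
  into two blocks, and the resulting binary minor takes the values of \<open>g\<close> at the two
  constants, at \<open>a\<close> and at its complement.\<close>

lemma two_block_value:
  fixes g :: bfn and x :: "nat \<Rightarrow> bool"
  shows "g (\<lambda>i. x (if a i then 0 else 1)) =
    (if x 0 then if x 1 then g (\<lambda>_. True) else g a
     else if x 1 then g (\<lambda>i. \<not> a i) else g (\<lambda>_. False))"
proof -
  have "(\<lambda>i. x (if a i then 0 else 1)) =
    (if x 0 then if x 1 then (\<lambda>_. True) else a else if x 1 then (\<lambda>i. \<not> a i) else (\<lambda>_. False))"
    by (auto simp: fun_eq_iff)
  then show ?thesis by simp
qed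

text \<open>Meant in contraposed form: a non-affine function comes with two points at which
  additivity fails, and this defect supplies majority or a product below.\<close>

lemma additive_imp_affine:
  assumes dep: "depends_below n g" and add: "\<And>a b. g (\<lambda>i. a i \<noteq> b i) = (g a \<noteq> g b)"
  shows "affine n g"
proof -
  define S where "S = {i\<in>{..<n}. g (\<lambda>j. j = i)}"
  have zero: "\<not> g (\<lambda>_. False)" using add[of "\<lambda>_. False" "\<lambda>_. False"] by simp
  have "g (\<lambda>i. i < k \<and> a i) = odd (card {i\<in>S. i < k \<and> a i})" if "k \<le> n" for k a
    using that
  proof (induction k)
    case 0
    then show ?case using zero by simp
  next
    case (Suc k)
    have "(\<lambda>i. i < Suc k \<and> a i) = (\<lambda>i. (i < k \<and> a i) \<noteq> (i = k \<and> a k))"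
      by (auto simp: fun_eq_iff less_Suc_eq)
    then have "g (\<lambda>i. i < Suc k \<and> a i) = g (\<lambda>i. (i < k \<and> a i) \<noteq> (i = k \<and> a k))"
      by (rule arg_cong)
    also have "\<dots> = (g (\<lambda>i. i < k \<and> a i) \<noteq> g (\<lambda>i. i = k \<and> a k))"
      by (rule add)
    also have "g (\<lambda>i. i = k \<and> a k) = (a k \<and> k \<in> S)"
      using zero Suc.prems by (cases "a k") (auto simp: S_def)
    also have "g (\<lambda>i. i < k \<and> a i) = odd (card {i\<in>S. i < k \<and> a i})" using Suc by simp
    also have "(odd (card {i\<in>S. i < k \<and> a i}) \<noteq> (a k \<and> k \<in> S)) = odd (card {i\<in>S. i < Suc k \<and> a i})"
    proof -
      have "{i\<in>S. i < Suc k \<and> a i} =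
          (if a k \<and> k \<in> S then insert k {i\<in>S. i < k \<and> a i} else {i\<in>S. i < k \<and> a i})"
        by (auto simp: less_Suc_eq)
      then show ?thesis by simp
    qed
    finally show ?case .
  qed
  from this[of n] have *: "g (\<lambda>i. i < n \<and> a i) = odd (card {i\<in>S. i < n \<and> a i})" for a by simp
  have "g a = (False \<noteq> odd (card {i\<in>S. a i}))" for a
  proof -
    have "g a = g (\<lambda>i. i < n \<and> a i)" by (rule depends_belowD[OF dep]) simp
    moreover have "{i\<in>S. i < n \<and> a i} = {i\<in>S. a i}" by (auto simp: S_def)
    ultimately show ?thesis using *[of a] by simp
  qed
  moreover have "S \<subseteq> {..<n}" by (auto simp: S_def)
  ultimately show ?thesis unfolding affine_def by blast
qed

text \<open>When \<open>a\<close> is changed into \<open>b\<close> one argument at a time, the value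
  must change at some step.\<close>

lemma sensitive_variable:
  assumes "depends_below n g" "g a \<noteq> g b"
  shows "\<exists>i<n. \<exists>c. g (c(i := False)) \<noteq> g (c(i := True))"
proof (rule ccontr)
  assume neg: "\<not> (\<exists>i<n. \<exists>c. g (c(i := False)) \<noteq> g (c(i := True)))"
  have flip: "g (c(i := x)) = g (c(i := y))" if "i < n" for i c x y
  proof -
    have "g (c(i := False)) = g (c(i := True))" using neg that by blast
    then show ?thesis by (cases x; cases y) simp_all
  qed
  have "g (\<lambda>i. if i < k then b i else a i) = g a" if "k \<le> n" for k
    using that
  proof (induction k)
    case (Suc k)
    define c where "c = (\<lambda>i. if i < k then b i else a i)"
    have "(\<lambda>i. if i < Suc k then b i else a i) = c(k := b k)" "c = c(k := a k)"
      by (auto simp: c_def fun_eq_iff less_Suc_eq)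
    then show ?case using flip[of k c "b k" "a k"] Suc by (simp add: c_def)
  qed simp
  from this[of n] have "g (\<lambda>i. if i < n then b i else a i) = g a" by simp
  moreover have "g (\<lambda>i. if i < n then b i else a i) = g b"
    by (rule depends_belowD[OF assms(1)]) simp
  ultimately show False using assms(2) by simp
qed

section \<open>Operations obtained in a class closed under composition\<close>

context comp_closed
begin

lemma comp1: "P 1 (\<lambda>a. F (a 0)) \<Longrightarrow> P m p \<Longrightarrow> P m (\<lambda>a. F (p a))"
  using compI[of 1 "\<lambda>a. F (a 0)" m "\<lambda>_. p"] by simp

lemma comp2:
  assumes "P 2 (\<lambda>a. F (a 0) (a 1))" "P m p" "P m q"
  shows "P m (\<lambda>a. F (p a) (q a))"
  using compI[OF assms(1), of m "\<lambda>i. if i = 0 then p else q"] assms(2,3) by simp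

lemma comp3:
  assumes "P 3 (\<lambda>a. F (a 0) (a 1) (a 2))" "P m p" "P m q" "P m r"
  shows "P m (\<lambda>a. F (p a) (q a) (r a))"
  using compI[OF assms(1), of m "\<lambda>i. if i = 0 then p else if i = 1 then q else r"] assms(2-4) by simp

lemma ident1: "P 1 (\<lambda>a. a 0) \<Longrightarrow> i < m \<Longrightarrow> P m (\<lambda>a. a i)"
  using minorI[of 1 "\<lambda>a. a 0" m "\<lambda>_. i"] by simp

lemma ident2:
  assumes "P 2 (\<lambda>a. F (a 0) (a 1))" "i < m" "j < m"
  shows "P m (\<lambda>a. F (a i) (a j))"
  using minorI[OF assms(1), of m "\<lambda>l. if l = 0 then i else j"] assms(2,3) by simp

lemma ident3:
  assumes "P 3 (\<lambda>a. F (a 0) (a 1) (a 2))" "i < m" "j < m" "k < m"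
  shows "P m (\<lambda>a. F (a i) (a j) (a k))"
  using minorI[OF assms(1), of m "\<lambda>l. if l = 0 then i else if l = 1 then j else k"] assms(2-4) by simp

lemma diagonal: "P n g \<Longrightarrow> P 1 (\<lambda>a. g (\<lambda>_. a 0))"
  using minorI[of n g 1 "\<lambda>_. 0"] by simp

lemma two_blocks:
  assumes "P n g"
  shows "P 2 (\<lambda>x. if x 0 then if x 1 then g (\<lambda>_. True) else g a
     else if x 1 then g (\<lambda>i. \<not> a i) else g (\<lambda>_. False))"
  using minorI[OF assms, of 2 "\<lambda>i. if a i then 0 else 1"] unfolding two_block_value by simp

lemma proj_of_idempotent:
  assumes "P n g" "\<not> g (\<lambda>_. False)" "g (\<lambda>_. True)"
  shows "P 1 (\<lambda>a. a 0)"
proof -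
  have "g (\<lambda>_. x) = x" for x using assms(2,3) by (cases x) auto
  then show ?thesis using diagonal[OF assms(1)] by simp
qed

lemma depends_below_maj:
  assumes "depends_below m p" "depends_below m q" "depends_below m r"
  shows "depends_below m (\<lambda>a. maj (p a) (q a) (r a))"
  unfolding depends_below_def
proof (intro allI impI)
  fix a b :: "nat \<Rightarrow> bool" assume "\<forall>i<m. a i = b i"
  then have "p a = p b" "q a = q b" "r a = r b"
    using assms unfolding depends_below_def by simp_all
  then show "maj (p a) (q a) (r a) = maj (p b) (q b) (r b)" by simp
qed

lemma depends_below_proj: "i < m \<Longrightarrow> depends_below m (\<lambda>a. a i)"
  unfolding depends_below_def by simp

lemma maj_self_dual:
  assumes "P 1 (\<lambda>a. a 0)" "P 3 (\<lambda>a. maj (a 0) (a 1) (a 2))"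
    and f: "depends_below m f" "monotone_fn f" "self_dual f"
  shows "P m f"
proof -
  have "f \<in> {r. P m r}"
    by (rule self_dual_monotone_generated[OF _ _ _ f])
      (simp_all add: ident1[OF assms(1)] comp3[OF assms(2)] dep)
  then show ?thesis by simp
qed

text \<open>Below a fixed variable both meets and joins are available. The functions whose
  conjunction with \<open>a i\<close> lies in the class are therefore closed under majority, and
  interpolation applies to them.\<close>

lemma and_or_self_dual:
  assumes "P 1 (\<lambda>a. a 0)" and q: "P 3 (\<lambda>a. a 0 \<and> (a 1 \<or> a 2))" and i: "i < m"
    and f: "depends_below m f" "monotone_fn f" "self_dual f"
  shows "P m (\<lambda>a. a i \<and> f a)"
proof -
  have andP: "P 2 (\<lambda>a. a 0 \<and> a 1)"
    using ident3[where F = "\<lambda>x y z. x \<and> (y \<or> z)", OF q, of 0 2 1 1] by simp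
  have xi: "P m (\<lambda>a. a i)" using ident1[OF assms(1) i] .
  define S where "S = {r. depends_below m r \<and> P m (\<lambda>a. a i \<and> r a)}"
  have conj: "P m (\<lambda>a. a i \<and> (r a \<and> s a))" if "P m (\<lambda>a. a i \<and> r a)" "P m (\<lambda>a. a i \<and> s a)" for r s
  proof -
    have "(\<lambda>a. a i \<and> (r a \<and> s a)) = (\<lambda>a. (a i \<and> r a) \<and> (a i \<and> s a))" by auto
    then show ?thesis using comp2[where F = "(\<and>)", OF andP that] by simp
  qed
  have disj: "P m (\<lambda>a. a i \<and> (r a \<or> s a))" if "P m (\<lambda>a. a i \<and> r a)" "P m (\<lambda>a. a i \<and> s a)" for r s
  proof -
    have "(\<lambda>a. a i \<and> (r a \<or> s a)) = (\<lambda>a. a i \<and> ((a i \<and> r a) \<or> (a i \<and> s a)))" by auto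
    then show ?thesis using comp3[where F = "\<lambda>x y z. x \<and> (y \<or> z)", OF q xi that] by simp
  qed
  have "f \<in> S"
  proof (rule self_dual_monotone_generated[OF _ _ _ f])
    show "(\<lambda>a. a j) \<in> S" if "j < m" for j
      using ident2[where F = "(\<and>)", OF andP i that] depends_below_proj[OF that] by (simp add: S_def)
    show "(\<lambda>a. maj (p a) (q a) (r a)) \<in> S" if "p \<in> S" "q \<in> S" "r \<in> S" for p q r
      using that depends_below_maj[of m p q r] conj disj by (simp add: S_def maj_def)
  qed (simp add: S_def)
  then show ?thesis by (simp add: S_def)
qed

text \<open>A nonconstant function whose true points form an upward closed set closed under meets is
  a conjunction of variables. So one of the two closure properties fails. A failing meet yields the
  disjunction below \<open>x 0\<close> directly; a failing monotonicity yields implication, and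
  \<open>(y \<longrightarrow> z) \<longrightarrow> z\<close> is disjunction.\<close>

lemma and_or_of_nonconjunctive:
  assumes g: "P n g" "\<not> g (\<lambda>_. False)" "g (\<lambda>_. True)"
    and andP: "P 2 (\<lambda>a. a 0 \<and> a 1)" and nonconj: "\<not> conjunctive n g"
  shows "P 3 (\<lambda>a. a 0 \<and> (a 1 \<or> a 2))"
proof -
  have dg: "depends_below n g" using dep[OF g(1)] .
  have id: "P 1 (\<lambda>a. a 0)" using proj_of_idempotent[OF g] .
  have x: "P 3 (\<lambda>a. a 0)" "P 3 (\<lambda>a. a 1)" "P 3 (\<lambda>a. a 2)" using ident1[OF id] by simp_all
  have conj: "P 3 (\<lambda>a. r a \<and> s a)" if "P 3 r" "P 3 s" for r s
    using comp2[where F = "(\<and>)", OF andP that] .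
  show ?thesis
  proof (cases "\<exists>a b. g a \<and> g b \<and> \<not> g (\<lambda>i. a i \<and> b i)")
    case True
    then obtain a b where ab: "g a" "g b" "\<not> g (\<lambda>i. a i \<and> b i)" by blast
    \<comment> \<open>For true \<open>x 0\<close> the arguments of \<open>g\<close> form the
      constant True, \<open>a\<close>, \<open>b\<close> or their meet, according to
      \<open>x 1\<close> and \<open>x 2\<close>; only the meet is a false point.\<close>
    define r :: "nat \<Rightarrow> bfn" where "r = (\<lambda>i. if a i \<and> b i then (\<lambda>x. x 0) else if a i then (\<lambda>x. x 0 \<and> x 1)
      else if b i then (\<lambda>x. x 0 \<and> x 2) else (\<lambda>x. x 0 \<and> (x 1 \<and> x 2)))"
    have "P 3 (r i)" for i unfolding r_def using x conj by simp
    then have "P 3 (\<lambda>x. g (\<lambda>i. r i x))" using compI[OF g(1)] by simp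
    then have "P 3 (\<lambda>x. x 0 \<and> g (\<lambda>i. r i x))" by (rule conj[OF x(1)])
    moreover have "(x 0 \<and> g (\<lambda>i. r i x)) = (x 0 \<and> (x 1 \<or> x 2))" for x
    proof (cases "x 0")
      case True
      then have "(\<lambda>i. r i x) = (if x 1 then if x 2 then (\<lambda>_. True) else a
          else if x 2 then b else (\<lambda>i. a i \<and> b i))"
        by (auto simp: r_def fun_eq_iff)
      then show ?thesis using True ab g(3) by simp
    qed simp
    ultimately show ?thesis by simp
  next
    case meet: False
    show ?thesis
    proof (cases "\<exists>a b. (\<forall>i. a i \<longrightarrow> b i) \<and> g a \<and> \<not> g b")
      case True
      then obtain a b where ab: "\<And>i. a i \<Longrightarrow> b i" "g a" "\<not> g b" by blast
      \<comment> \<open>For true \<open>x 0\<close> this gives \<open>a\<close> if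
        \<open>x 1\<close> is False, and otherwise \<open>b\<close> or the constant True according
        to \<open>x 2\<close>.\<close>
      define r :: "nat \<Rightarrow> bfn" where "r = (\<lambda>i. if a i then (\<lambda>x. x 0) else if b i then (\<lambda>x. x 0 \<and> x 1)
        else (\<lambda>x. x 0 \<and> (x 1 \<and> x 2)))"
      have "P 3 (r i)" for i unfolding r_def using x conj by simp
      then have "P 3 (\<lambda>x. g (\<lambda>i. r i x))" using compI[OF g(1)] by simp
      then have "P 3 (\<lambda>x. x 0 \<and> g (\<lambda>i. r i x))" by (rule conj[OF x(1)])
      moreover have "(x 0 \<and> g (\<lambda>i. r i x)) = (x 0 \<and> (x 1 \<longrightarrow> x 2))" for x
      proof (cases "x 0")
        case True
        then have "(\<lambda>i. r i x) = (if x 1 then if x 2 then (\<lambda>_. True) else b else a)"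
          using ab(1) by (auto simp: r_def fun_eq_iff)
        then show ?thesis using True ab g(3) by simp
      qed simp
      ultimately have imp: "P 3 (\<lambda>x. x 0 \<and> (x 1 \<longrightarrow> x 2))" by simp
      have "P 3 (\<lambda>a. a 0 \<and> ((a 0 \<and> (a 1 \<longrightarrow> a 2)) \<longrightarrow> a 2))"
        using comp3[where F = "\<lambda>x y z. x \<and> (y \<longrightarrow> z)", OF imp x(1) imp x(3)] .
      moreover have "(\<lambda>a :: nat \<Rightarrow> bool. a 0 \<and> ((a 0 \<and> (a 1 \<longrightarrow> a 2)) \<longrightarrow> a 2)) =
          (\<lambda>a. a 0 \<and> (a 1 \<or> a 2))" by auto
      ultimately show ?thesis by simp
    next
      case up: False
      define S where "S = {i\<in>{..<n}. \<forall>a. g a \<longrightarrow> a i}"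
      have "\<forall>j\<in>{..<n} - S. \<exists>a. g a \<and> \<not> a j" by (auto simp: S_def)
      then obtain h where h: "\<And>j. j \<in> {..<n} - S \<Longrightarrow> g (h j) \<and> \<not> h j j" by metis
      have meets: "g (\<lambda>i. \<forall>j\<in>J. h j i)" if "finite J" "J \<subseteq> {..<n} - S" for J
        using that
      proof (induction J)
        case (insert j J)
        then have "g (h j)" "g (\<lambda>i. \<forall>j\<in>J. h j i)" using h by auto
        then have "g (\<lambda>i. h j i \<and> (\<forall>j\<in>J. h j i))" using meet by blast
        then show ?case by simp
      qed (use g(3) in simp)
      have "g a = (\<forall>i\<in>S. a i)" for a
      proof
        assume all: "\<forall>i\<in>S. a i"
        \<comment> \<open>The meet of the witnesses \<open>h j\<close> is a true point that vanishes
          off \<open>S\<close> below \<open>n\<close>. From \<open>n\<close> on it is replaced by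
          \<open>a\<close>, because \<open>up\<close> compares all indices.\<close>
        define c where "c = (\<lambda>i. if i < n then \<forall>j\<in>{..<n} - S. h j i else a i)"
        have "g c = g (\<lambda>i. \<forall>j\<in>{..<n} - S. h j i)"
          by (rule depends_belowD[OF dg]) (simp add: c_def)
        then have "g c" using meets[of "{..<n} - S"] by simp
        moreover have "\<forall>i. c i \<longrightarrow> a i" using all h by (auto simp: c_def)
        ultimately show "g a" using up by blast
      qed (auto simp: S_def)
      moreover from this g(2) have "S \<noteq> {}" by auto
      moreover have "S \<subseteq> {..<n}" by (auto simp: S_def)
      ultimately have "conjunctive n g" unfolding conjunctive_def by blast
      with nonconj show ?thesis ..
    qed
  qed
qed

text \<open>A self-dual \<open>H\<close> that is False at the constant False is determined by its
  values at the three unit points. An odd number of True values gives a projection or the sum of all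
  three variables; an even number, assumed here, gives majority or majority with one argument
  negated.\<close>

lemma maj_of_ternary:
  assumes H: "P 3 (\<lambda>a. H (a 0) (a 1) (a 2))" "\<not> H False False False"
    and dual: "\<And>x y z. H (\<not> x) (\<not> y) (\<not> z) = (\<not> H x y z)"
    and even: "H True False False = (H False True False \<noteq> H False False True)"
    and id: "P 1 (\<lambda>a. a 0)"
  shows "P 3 (\<lambda>a. maj (a 0) (a 1) (a 2))"
proof -
  \<comment> \<open>Substituting the operation into its own negated argument removes the
    negation.\<close>
  have neg3: "P 3 (\<lambda>a. maj (a 0) (a 1) (a 2))" if K: "P 3 (\<lambda>a. maj (a 0) (a 1) (\<not> a 2))"
  proof -
    have "P 3 (\<lambda>a. maj (a 0) (a 1) (\<not> maj (a 0) (a 1) (\<not> a 2)))"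
      using comp3[where F = "\<lambda>x y z. maj x y (\<not> z)", OF K _ _ K, of "\<lambda>a. a 0" "\<lambda>a. a 1"]
        ident1[OF id] by simp
    moreover have "maj x y (\<not> maj x y (\<not> z)) = maj x y z" for x y z by (auto simp: maj_def)
    ultimately show ?thesis by simp
  qed
  have vals: "H True True True" "H True True False = (\<not> H False False True)"
    "H True False True = (\<not> H False True False)" "H False True True = (\<not> H True False False)"
    using dual[of False False False] dual[of False False True] dual[of False True False]
      dual[of True False False] H(2) by simp_all
  consider "\<not> H True False False" "\<not> H False True False" "\<not> H False False True"
    | "H True False False" "H False True False" "\<not> H False False True"
    | "H True False False" "\<not> H False True False" "H False False True"
    | "\<not> H True False False" "H False True False" "H False False True"
    using even by blast
  then show ?thesis
  proof cases
    case 1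
    then have "H x y z = maj x y z" for x y z
      using vals H(2) by (cases x; cases y; cases z) (simp_all add: maj_def)
    then show ?thesis using H(1) by simp
  next
    case 2
    then have "H x y z = maj x y (\<not> z)" for x y z
      using vals H(2) by (cases x; cases y; cases z) (simp_all add: maj_def)
    then show ?thesis using H(1) by (intro neg3) simp
  next
    case 3
    then have "H x y z = maj x z (\<not> y)" for x y z
      using vals H(2) by (cases x; cases y; cases z) (simp_all add: maj_def)
    then show ?thesis using ident3[where F = H, OF H(1), of 0 3 2 1] by (intro neg3) simp
  next
    case 4
    then have "H x y z = maj y z (\<not> x)" for x y z
      using vals H(2) by (cases x; cases y; cases z) (simp_all add: maj_def)
    then show ?thesis using ident3[where F = H, OF H(1), of 2 3 0 1] by (intro neg3) simp
  qed
qed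

text \<open>The defect of additivity at \<open>a\<close>, \<open>b\<close> cuts the variables into
  four blocks. \<open>H1\<close>, \<open>H2\<close>, \<open>H3\<close> are the ternary minors that
  merge two of them: those where \<open>b\<close> is False, where \<open>a\<close> is False, and
  where \<open>a\<close> and \<open>b\<close> agree.\<close>

lemma maj_of_self_dual:
  assumes g: "P n g" "\<not> g (\<lambda>_. False)" and dual: "\<And>a. g (\<lambda>i. \<not> a i) = (\<not> g a)"
    and nonaffine: "\<not> affine n g"
  shows "P 3 (\<lambda>a. maj (a 0) (a 1) (a 2))"
proof -
  have gT: "g (\<lambda>_. True)" using dual[of "\<lambda>_. False"] g(2) by simp
  have id: "P 1 (\<lambda>a. a 0)" using proj_of_idempotent[OF g gT] .
  obtain a b where ab: "g (\<lambda>i. a i \<noteq> b i) \<noteq> (g a \<noteq> g b)"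
    using additive_imp_affine[OF dep[OF g(1)]] nonaffine by blast
  have gcong: "g u = g v" if "\<And>i. u i = v i" for u v using that by presburger
  have gneg: "g u = (\<not> g v)" if "\<And>i. u i = (\<not> v i)" for u v
    using gcong[of u "\<lambda>i. \<not> v i"] that dual[of v] by simp
  define H1 where "H1 x y z = g (\<lambda>i. if b i then if a i then z else y else x)" for x y z
  define H2 where "H2 x y z = g (\<lambda>i. if a i then if b i then z else y else x)" for x y z
  define H3 where "H3 x y z = g (\<lambda>i. if a i = b i then x else if a i then y else z)" for x y z
  have mem: "P 3 (\<lambda>x. g (\<lambda>i. x (\<sigma> i)))" if "\<And>i. \<sigma> i < 3" for \<sigma>
    using minorI[OF g(1), of 3 \<sigma>] that by simp
  have mem1: "P 3 (\<lambda>x. H1 (x 0) (x 1) (x 2))"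
  proof -
    have "(\<lambda>x :: nat \<Rightarrow> bool. H1 (x 0) (x 1) (x 2)) = (\<lambda>x. g (\<lambda>i. x (if b i then if a i then 2 else 1 else 0)))"
      unfolding H1_def by (intro ext arg_cong[where f = g]) auto
    moreover have "P 3 (\<lambda>x. g (\<lambda>i. x (if b i then if a i then 2 else 1 else 0)))" by (rule mem) simp
    ultimately show ?thesis by simp
  qed
  have mem2: "P 3 (\<lambda>x. H2 (x 0) (x 1) (x 2))"
  proof -
    have "(\<lambda>x :: nat \<Rightarrow> bool. H2 (x 0) (x 1) (x 2)) = (\<lambda>x. g (\<lambda>i. x (if a i then if b i then 2 else 1 else 0)))"
      unfolding H2_def by (intro ext arg_cong[where f = g]) auto
    moreover have "P 3 (\<lambda>x. g (\<lambda>i. x (if a i then if b i then 2 else 1 else 0)))" by (rule mem) simp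
    ultimately show ?thesis by simp
  qed
  have mem3: "P 3 (\<lambda>x. H3 (x 0) (x 1) (x 2))"
  proof -
    have "(\<lambda>x :: nat \<Rightarrow> bool. H3 (x 0) (x 1) (x 2)) = (\<lambda>x. g (\<lambda>i. x (if a i = b i then 0 else if a i then 1 else 2)))"
      unfolding H3_def by (intro ext arg_cong[where f = g]) auto
    moreover have "P 3 (\<lambda>x. g (\<lambda>i. x (if a i = b i then 0 else if a i then 1 else 2)))" by (rule mem) simp
    ultimately show ?thesis by simp
  qed
  have zero: "\<not> H1 False False False" "\<not> H2 False False False" "\<not> H3 False False False"
    unfolding H1_def H2_def H3_def if_cancel using g(2) by simp_all
  have dualH: "H1 (\<not> x) (\<not> y) (\<not> z) = (\<not> H1 x y z)" "H2 (\<not> x) (\<not> y) (\<not> z) = (\<not> H2 x y z)"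
    "H3 (\<not> x) (\<not> y) (\<not> z) = (\<not> H3 x y z)" for x y z
    unfolding H1_def H2_def H3_def by (rule gneg, simp)+
  have v1: "H1 True False False = (\<not> g b)" "H1 False True False = g (\<lambda>i. b i \<and> \<not> a i)"
    "H1 False False True = g (\<lambda>i. a i \<and> b i)"
    unfolding H1_def by (rule gneg, force) (rule gcong, force)+
  have v2: "H2 True False False = (\<not> g a)" "H2 False True False = g (\<lambda>i. a i \<and> \<not> b i)"
    "H2 False False True = g (\<lambda>i. a i \<and> b i)"
    unfolding H2_def by (rule gneg, force) (rule gcong, force)+
  have v3: "H3 True False False = (\<not> g (\<lambda>i. a i \<noteq> b i))" "H3 False True False = g (\<lambda>i. a i \<and> \<not> b i)"
    "H3 False False True = g (\<lambda>i. b i \<and> \<not> a i)"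
    unfolding H3_def by (rule gneg, force) (rule gcong, force)+
  \<comment> \<open>Add all nine unit values modulo 2: the values at the three disjoint blocks occur
    twice each, and what remains is even by \<open>ab\<close>. So one of the three minors has even
    parity.\<close>
  consider "H1 True False False = (H1 False True False \<noteq> H1 False False True)"
    | "H2 True False False = (H2 False True False \<noteq> H2 False False True)"
    | "H3 True False False = (H3 False True False \<noteq> H3 False False True)"
    unfolding v1 v2 v3 using ab by argo
  then show ?thesis
  proof cases
    case 1
    show ?thesis by (rule maj_of_ternary[where H = H1, OF mem1 zero(1) dualH(1) 1 id])
  next
    case 2
    show ?thesis by (rule maj_of_ternary[where H = H2, OF mem2 zero(2) dualH(2) 2 id])
  next
    case 3
    show ?thesis by (rule maj_of_ternary[where H = H3, OF mem3 zero(3) dualH(3) 3 id])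
  qed
qed

text \<open>Identifying all variables yields negation. If \<open>g\<close> is self-dual, its
  complement falls under \<open>maj_of_self_dual\<close>; otherwise a point with the same value as
  its complement yields NAND or NOR, hence conjunction and with negation everything.\<close>

lemma maj_of_negation:
  assumes g: "P n g" "g (\<lambda>_. False)" "\<not> g (\<lambda>_. True)" and nonaffine: "\<not> affine n g"
  shows "P 1 (\<lambda>a. a 0) \<and> P 3 (\<lambda>a. maj (a 0) (a 1) (a 2))"
proof -
  have "g (\<lambda>_. x) = (\<not> x)" for x using g(2,3) by (cases x) auto
  then have notP: "P 1 (\<lambda>a. \<not> a 0)" using diagonal[OF g(1)] by simp
  note neg = comp1[where F = Not, OF notP]
  have id: "P 1 (\<lambda>a. a 0)" using neg[OF notP] by simp
  have "P 3 (\<lambda>a. maj (a 0) (a 1) (a 2))"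
  proof (cases "\<forall>a. g (\<lambda>i. \<not> a i) = (\<not> g a)")
    case True
    show ?thesis
    proof (rule maj_of_self_dual)
      show "P n (\<lambda>a. \<not> g a)" using neg[OF g(1)] .
      show "\<not> affine n (\<lambda>a. \<not> g a)"
      proof
        assume "affine n (\<lambda>a. \<not> g a)"
        then obtain S c where S: "S \<subseteq> {..<n}" "\<And>a. (\<not> g a) = (c \<noteq> odd (card {i\<in>S. a i}))"
          unfolding affine_def by blast
        have "g a = ((\<not> c) \<noteq> odd (card {i\<in>S. a i}))" for a using S(2)[of a] by blast
        with S(1) nonaffine show False unfolding affine_def by blast
      qed
    qed (use g True in auto)
  next
    case False
    then obtain a where a: "g (\<lambda>i. \<not> a i) = g a" by blast
    have andP: "P 2 (\<lambda>x. x 0 \<and> x 1)"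
    proof (cases "g a")
      case True
      then have "(\<lambda>x :: nat \<Rightarrow> bool. if x 0 then if x 1 then g (\<lambda>_. True) else g a
          else if x 1 then g (\<lambda>i. \<not> a i) else g (\<lambda>_. False)) = (\<lambda>x. \<not> (x 0 \<and> x 1))"
        using a g(2,3) by (simp add: fun_eq_iff)
      then have "P 2 (\<lambda>x. \<not> (x 0 \<and> x 1))"
        using two_blocks[OF g(1), of a] by (simp only:)
      from neg[OF this] show ?thesis by simp
    next
      case False
      then have "(\<lambda>x :: nat \<Rightarrow> bool. if x 0 then if x 1 then g (\<lambda>_. True) else g a
          else if x 1 then g (\<lambda>i. \<not> a i) else g (\<lambda>_. False)) = (\<lambda>x. \<not> x 0 \<and> \<not> x 1)"
        using a g(2,3) by (simp add: fun_eq_iff)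
      then have "P 2 (\<lambda>x. \<not> x 0 \<and> \<not> x 1)"
        using two_blocks[OF g(1), of a] by (simp only:)
      then have "P 2 (\<lambda>x. \<not> (\<not> x 0) \<and> \<not> (\<not> x 1))"
        by (rule comp2[where F = "\<lambda>x y. \<not> x \<and> \<not> y"]) (use neg ident1[OF id] in auto)
      then show ?thesis by simp
    qed
    note conj = comp2[where F = "(\<and>)", OF andP]
    have pair: "P 3 (\<lambda>x. \<not> (x i \<and> x j))" if "i < 3" "j < 3" for i j
      using neg[OF conj[OF ident1[OF id that(1)] ident1[OF id that(2)]]] .
    have "P 3 (\<lambda>x. \<not> (\<not> (x 0 \<and> x 1) \<and> \<not> (x 0 \<and> x 2) \<and> \<not> (x 1 \<and> x 2)))"
      by (intro neg conj pair) simp_all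
    moreover have "(\<lambda>x :: nat \<Rightarrow> bool. \<not> (\<not> (x 0 \<and> x 1) \<and> \<not> (x 0 \<and> x 2) \<and> \<not> (x 1 \<and> x 2))) =
        (\<lambda>x. maj (x 0) (x 1) (x 2))" by (auto simp: maj_def)
    ultimately show ?thesis by simp
  qed
  with id show ?thesis ..
qed

end

section \<open>Building the extensions from a function with suitable operations\<close>

definition antichain_extendable :: "nat \<Rightarrow> bfn \<Rightarrow> bool" where
  "antichain_extendable n g \<longleftrightarrow> (\<exists>G i. i < n \<and> (\<forall>y. depends_below n (\<lambda>a. G a y)) \<and>
     (\<exists>d. G d False \<noteq> G d True) \<and> (\<forall>a. G a (a i) = g a) \<and>
     (\<forall>k\<ge>3. generated n g (n + k + 1) (extension n G k)))"

lemma beta_shift: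
  assumes "k \<ge> 3"
  shows "depends_below (n + k + 1) (\<lambda>a. beta k (\<lambda>i. a (n + i)))"
    and "monotone_fn (\<lambda>a. beta k (\<lambda>i. a (n + i)))"
    and "self_dual (\<lambda>a. beta k (\<lambda>i. a (n + i)))"
proof -
  show "depends_below (n + k + 1) (\<lambda>a. beta k (\<lambda>i. a (n + i)))"
    by (rule depends_below_minor[OF depends_below_beta]) simp
  show "monotone_fn (\<lambda>a. beta k (\<lambda>i. a (n + i)))"
    unfolding monotone_fn_def
  proof (intro allI impI)
    fix a b :: "nat \<Rightarrow> bool" assume "\<forall>i. a i \<longrightarrow> b i" "beta k (\<lambda>i. a (n + i))"
    then show "beta k (\<lambda>i. b (n + i))"
      by (intro monotone_fnD[OF monotone_beta, of "\<lambda>i. a (n + i)" "\<lambda>i. b (n + i)"]) simp_all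
  qed
  show "self_dual (\<lambda>a. beta k (\<lambda>i. a (n + i)))"
    using self_dual_beta[OF assms] by (simp add: self_dual_def)
qed

lemma depends_below_update:
  assumes "depends_below n g" "\<And>a b. (\<forall>j<n. a j = b j) \<Longrightarrow> h a = h b"
  shows "depends_below n (\<lambda>a. g (a(i := h a)))"
  unfolding depends_below_def
proof (intro allI impI)
  fix a b :: "nat \<Rightarrow> bool" assume ab: "\<forall>j<n. a j = b j"
  show "g (a(i := h a)) = g (b(i := h b))"
    by (rule depends_belowD[OF assms(1)]) (use ab assms(2)[OF ab] in simp)
qed

text \<open>A sensitive variable \<open>a i\<close> is replaced by \<open>\<theta> (a i) y\<close>.
  Idempotence of \<open>\<theta>\<close> returns \<open>g\<close> when \<open>y\<close> is
  identified with \<open>a i\<close>, and the left unit \<open>e\<close> keeps the result sensitive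
  to \<open>y\<close>. The uses are conjunction and the second projection.\<close>

lemma extendable_by_substitution:
  assumes n: "n \<ge> 1" "depends_below n g" "g u \<noteq> g v"
    and \<theta>: "\<And>x. \<theta> x x = x" "\<And>y. \<theta> e y = y"
    and id: "generated n g 1 (\<lambda>a. a 0)"
    and gen: "\<And>i m f. i < m \<Longrightarrow> depends_below m f \<Longrightarrow> monotone_fn f \<Longrightarrow> self_dual f \<Longrightarrow>
      generated n g m (\<lambda>a. \<theta> (a i) (f a))"
  shows "antichain_extendable n g"
proof -
  interpret comp_closed "generated n g" by (rule generated_closed[OF n(1,2)])
  obtain i c where i: "i < n" and c: "g (c(i := False)) \<noteq> g (c(i := True))"
    using sensitive_variable[OF n(2,3)] by blast
  define G where "G a y = g (a(i := \<theta> (a i) y))" for a y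
  have "depends_below n (\<lambda>a. G a y)" for y
    unfolding G_def by (rule depends_below_update[OF n(2)]) (use i in simp)
  moreover have "G (c(i := e)) False \<noteq> G (c(i := e)) True" using c by (simp add: G_def \<theta>(2))
  moreover have "G a (a i) = g a" for a by (simp add: G_def \<theta>(1))
  moreover have "generated n g (n + k + 1) (extension n G k)" if k: "k \<ge> 3" for k
  proof -
    let ?f = "\<lambda>a. beta k (\<lambda>j. a (n + j))"
    define r where "r j = (if j = i then (\<lambda>a. \<theta> (a i) (?f a)) else (\<lambda>a. a j))" for j
    have "generated n g (n + k + 1) (r j)" if "j < n" for j
      unfolding r_def using ident1[OF id, of j "n + k + 1"] that i
        gen[of i "n + k + 1", OF _ beta_shift[OF k]] by simp
    then have "generated n g (n + k + 1) (\<lambda>a. g (\<lambda>j. r j a))"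
      by (rule compI[OF generated.base])
    moreover have "(\<lambda>j. r j a) = a(i := \<theta> (a i) (?f a))" for a by (auto simp: r_def)
    ultimately show ?thesis by (simp add: extension_def G_def)
  qed
  ultimately show ?thesis using i unfolding antichain_extendable_def by blast
qed

definition dual_fn :: "bfn \<Rightarrow> bfn" where
  "dual_fn p = (\<lambda>a. \<not> p (\<lambda>i. \<not> a i))"

lemma dual_fn_dual_fn [simp]: "dual_fn (dual_fn p) = p"
  by (simp add: dual_fn_def)

lemma depends_below_dual_fn: "depends_below n p \<Longrightarrow> depends_below n (dual_fn p)"
  unfolding dual_fn_def depends_below_def by simp

lemma generated_dual:
  assumes "generated n (dual_fn g) m p"
  shows "generated n g m (dual_fn p)"
  using assms
proof induction
  case base
  then show ?case by (simp add: generated.base)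
next
  case (minor m p m' \<sigma>)
  have "generated n g m' (\<lambda>a. dual_fn p (\<lambda>i. a (\<sigma> i)))"
    by (rule generated.minor[OF minor.IH minor.hyps(2,3)])
  then show ?case by (simp add: dual_fn_def)
next
  case (comp m p m' r)
  have "generated n g m' (\<lambda>a. dual_fn p (\<lambda>i. dual_fn (r i) a))"
    by (rule generated.comp[OF comp.IH])
  then show ?case by (simp add: dual_fn_def)
qed

text \<open>Self-duality of \<open>beta k\<close> is what makes the dual of an extension again an
  extension by the same \<open>beta k\<close>.\<close>

lemma extendable_dual:
  assumes "antichain_extendable n (dual_fn g)"
  shows "antichain_extendable n g"
proof -
  obtain G i d where G: "i < n" "\<And>y. depends_below n (\<lambda>a. G a y)" "G d False \<noteq> G d True"
    "\<And>a. G a (a i) = dual_fn g a"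
    "\<And>k. k \<ge> 3 \<Longrightarrow> generated n (dual_fn g) (n + k + 1) (extension n G k)"
    using assms unfolding antichain_extendable_def by blast
  define G' where "G' a y = (\<not> G (\<lambda>i. \<not> a i) (\<not> y))" for a y
  have "depends_below n (\<lambda>a. G' a y)" for y
    using depends_below_dual_fn[OF G(2), of "\<not> y"] by (simp add: dual_fn_def G'_def)
  moreover have "G' (\<lambda>i. \<not> d i) False \<noteq> G' (\<lambda>i. \<not> d i) True" using G(3) by (simp add: G'_def)
  moreover have "G' a (a i) = g a" for a
    using G(4)[of "\<lambda>i. \<not> a i"] by (simp add: G'_def dual_fn_def)
  moreover have "generated n g (n + k + 1) (extension n G' k)" if k: "k \<ge> 3" for k
  proof -
    have "beta k (\<lambda>i. \<not> a (n + i)) = (\<not> beta k (\<lambda>i. a (n + i)))" for a :: "nat \<Rightarrow> bool"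
      using self_dual_beta[OF k] by (simp add: self_dual_def)
    then have "extension n G' k = dual_fn (extension n G k)"
      by (simp add: extension_def dual_fn_def G'_def)
    then show ?thesis using generated_dual[OF G(5)[OF k]] by simp
  qed
  ultimately show ?thesis using G(1) unfolding antichain_extendable_def by blast
qed

section \<open>The cases given by the values of the function at the constant points\<close>

lemma extendable_idempotent:
  assumes n: "n \<ge> 1" "depends_below n g" and g: "\<not> g (\<lambda>_. False)" "g (\<lambda>_. True)"
    and "\<not> simple n g"
  shows "antichain_extendable n g"
proof -
  have conj: "antichain_extendable n h"
    if h: "depends_below n h" "\<not> h (\<lambda>_. False)" "h (\<lambda>_. True)" "\<not> conjunctive n h"
      "\<not> h a" "\<not> h (\<lambda>i. \<not> a i)" for h a
  proof -
    interpret comp_closed "generated n h" by (rule generated_closed[OF n(1) h(1)])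
    have id: "generated n h 1 (\<lambda>a. a 0)" by (rule proj_of_idempotent[OF generated.base h(2,3)])
    have "(\<lambda>x :: nat \<Rightarrow> bool. if x 0 then if x 1 then h (\<lambda>_. True) else h a
        else if x 1 then h (\<lambda>i. \<not> a i) else h (\<lambda>_. False)) = (\<lambda>x. x 0 \<and> x 1)"
      using h(2,3,5,6) by (simp add: fun_eq_iff)
    then have "generated n h 2 (\<lambda>x. x 0 \<and> x 1)"
      using two_blocks[OF generated.base, of a] by (simp only:)
    then have q: "generated n h 3 (\<lambda>a. a 0 \<and> (a 1 \<or> a 2))"
      by (rule and_or_of_nonconjunctive[OF generated.base h(2,3) _ h(4)])
    show ?thesis
    proof (rule extendable_by_substitution[where \<theta> = "(\<and>)" and e = True])
      show "h (\<lambda>_. False) \<noteq> h (\<lambda>_. True)" using h(2,3) by simp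
      show "generated n h m (\<lambda>a. a i \<and> f a)"
        if "i < m" "depends_below m f" "monotone_fn f" "self_dual f" for i m f
        using and_or_self_dual[OF id q that] .
    qed (use n(1) h(1) id in simp_all)
  qed
  show ?thesis
  proof (cases "\<exists>a. \<not> g a \<and> \<not> g (\<lambda>i. \<not> a i)")
    case True
    then show ?thesis using conj[OF n(2) g] assms(5) by (auto simp: simple_def)
  next
    case no_and: False
    show ?thesis
    proof (cases "\<exists>a. g a \<and> g (\<lambda>i. \<not> a i)")
      case True
      then obtain a where a: "g a" "g (\<lambda>i. \<not> a i)" by blast
      have "\<not> simple n (dual_fn g)" using simple_dual[of n g] assms(5) by (auto simp: dual_fn_def)
      then have "\<not> conjunctive n (dual_fn g)" by (simp add: simple_def)
      then have "antichain_extendable n (dual_fn g)"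
        by (intro conj[of "dual_fn g" a] depends_below_dual_fn n(2))
          (use g a in \<open>simp_all add: dual_fn_def\<close>)
      then show ?thesis by (rule extendable_dual)
    next
      case False
      with no_and have dual: "g (\<lambda>i. \<not> a i) = (\<not> g a)" for a by blast
      interpret comp_closed "generated n g" by (rule generated_closed[OF n])
      have id: "generated n g 1 (\<lambda>a. a 0)" by (rule proj_of_idempotent[OF generated.base g])
      have maj: "generated n g 3 (\<lambda>a. maj (a 0) (a 1) (a 2))"
        by (rule maj_of_self_dual[OF generated.base g(1) dual]) (use assms(5) in \<open>simp add: simple_def\<close>)
      show ?thesis
      proof (rule extendable_by_substitution[where \<theta> = "\<lambda>x y. y" and e = True])
        show "g (\<lambda>_. False) \<noteq> g (\<lambda>_. True)" using g by simp
        show "generated n g m f" if "depends_below m f" "monotone_fn f" "self_dual f" for m f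
          using maj_self_dual[OF id maj that] .
      qed (use n id in simp_all)
    qed
  qed
qed

lemma extendable_negation:
  assumes n: "n \<ge> 1" "depends_below n g" and g: "g (\<lambda>_. False)" "\<not> g (\<lambda>_. True)"
    and "\<not> simple n g"
  shows "antichain_extendable n g"
proof -
  interpret comp_closed "generated n g" by (rule generated_closed[OF n])
  have "\<not> affine n g" using assms(5) by (simp add: simple_def)
  from maj_of_negation[OF generated.base g this]
  have id: "generated n g 1 (\<lambda>a. a 0)" and maj: "generated n g 3 (\<lambda>a. maj (a 0) (a 1) (a 2))"
    by simp_all
  show ?thesis
  proof (rule extendable_by_substitution[where \<theta> = "\<lambda>x y. y" and e = True])
    show "g (\<lambda>_. False) \<noteq> g (\<lambda>_. True)" using g by simp
    show "generated n g m f" if "depends_below m f" "monotone_fn f" "self_dual f" for m f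
      using maj_self_dual[OF id maj that] .
  qed (use n id in simp_all)
qed

text \<open>Every generated function is False at both constant points, so no projection is
  available, and \<open>g\<close> itself serves as the mask. Difference yields meets, and joins
  below a generated function. \<open>G\<close> removes from \<open>g\<close> the points where
  \<open>a i\<close> holds but \<open>y\<close> fails; it is sensitive at \<open>u\<close> because
  \<open>u i\<close> holds.\<close>

lemma extendable_difference:
  assumes n: "n \<ge> 1" "depends_below n g" and g: "\<not> g (\<lambda>_. False)" "\<not> g (\<lambda>_. True)"
    and u: "g u" "\<not> g (\<lambda>i. \<not> u i)"
  shows "antichain_extendable n g"
proof -
  interpret comp_closed "generated n g" by (rule generated_closed[OF n])
  have "(\<lambda>x :: nat \<Rightarrow> bool. if x 0 then if x 1 then g (\<lambda>_. True) else g u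
      else if x 1 then g (\<lambda>i. \<not> u i) else g (\<lambda>_. False)) = (\<lambda>x. x 0 \<and> \<not> x 1)"
    using g u by (simp add: fun_eq_iff)
  then have diff: "generated n g 2 (\<lambda>x. x 0 \<and> \<not> x 1)"
    using two_blocks[OF generated.base, of u] by (simp only:)
  note minus = comp2[where F = "\<lambda>x y. x \<and> \<not> y", OF diff]
  have inter: "generated n g m (\<lambda>a. p a \<and> q a)" if "generated n g m p" "generated n g m q" for m p q
    using minus[OF that(1) minus[OF that]] by (simp cong: conj_cong)
  have union: "generated n g m (\<lambda>a. r a \<and> (p a \<or> q a))"
    if r: "generated n g m r" and "generated n g m (\<lambda>a. r a \<and> p a)" "generated n g m (\<lambda>a. r a \<and> q a)"
    for m p q r
  proof -
    have "generated n g m (\<lambda>a. r a \<and> \<not> ((r a \<and> \<not> (r a \<and> p a)) \<and> \<not> (r a \<and> q a)))"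
      by (intro minus that)
    moreover have "(\<lambda>a. r a \<and> \<not> ((r a \<and> \<not> (r a \<and> p a)) \<and> \<not> (r a \<and> q a))) = (\<lambda>a. r a \<and> (p a \<or> q a))"
      by auto
    ultimately show ?thesis by simp
  qed
  have "\<exists>i<n. u i"
  proof (rule ccontr)
    assume neg: "\<not> (\<exists>i<n. u i)"
    have "g u = g (\<lambda>_. False)" by (rule depends_belowD[OF n(2)]) (use neg in blast)
    then show False using u(1) g(1) by simp
  qed
  then obtain i where i: "i < n" "u i" by blast
  define G where "G a y = (g a \<and> (a i \<longrightarrow> y))" for a y
  have "depends_below n (\<lambda>a. G a y)" for y
    unfolding depends_below_def
  proof (intro allI impI)
    fix a b :: "nat \<Rightarrow> bool" assume ab: "\<forall>i<n. a i = b i"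
    have "g a = g b" by (rule depends_belowD[OF n(2)]) (use ab in simp)
    then show "G a y = G b y" using ab i by (simp add: G_def)
  qed
  moreover have "G u False \<noteq> G u True" using u i by (simp add: G_def)
  moreover have "G a (a i) = g a" for a by (simp add: G_def)
  moreover have "generated n g (n + k + 1) (extension n G k)" if k: "k \<ge> 3" for k
  proof -
    define m where "m = n + k + 1"
    have gm: "generated n g m g"
      using minorI[OF generated.base, of m "\<lambda>i. i"] by (simp add: m_def)
    define S where "S = {r. depends_below m r \<and> generated n g m (\<lambda>a. g a \<and> r a)}"
    \<comment> \<open>Each true point of \<open>g\<close> has a False entry below \<open>n\<close>,
      since \<open>g\<close> is False at the constant True. Below \<open>g\<close>, the variable
      \<open>l\<close> is therefore the join over \<open>j < n\<close> of the differences of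
      variables \<open>l\<close> and \<open>j\<close>.\<close>
    have proj: "generated n g m (\<lambda>a. g a \<and> a l)" if l: "l < m" for l
    proof -
      have "generated n g m (\<lambda>a. g a \<and> (\<exists>j<t. a l \<and> \<not> a j))" if "t \<le> n" for t
        using that
      proof (induction t)
        case 0
        show ?case using minus[OF gm gm] by simp
      next
        case (Suc t)
        have "generated n g m (\<lambda>a. a l \<and> \<not> a t)"
          using ident2[where F = "\<lambda>x y. x \<and> \<not> y", OF diff l, of t] Suc.prems by (simp add: m_def)
        then have "generated n g m (\<lambda>a. g a \<and> (a l \<and> \<not> a t))" by (rule inter[OF gm])
        moreover have "generated n g m (\<lambda>a. g a \<and> (\<exists>j<t. a l \<and> \<not> a j))" using Suc by simp
        ultimately have "generated n g m (\<lambda>a. g a \<and> ((a l \<and> \<not> a t) \<or> (\<exists>j<t. a l \<and> \<not> a j)))"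
          by (rule union[OF gm])
        moreover have "(\<exists>j<Suc t. a l \<and> \<not> a j) = ((a l \<and> \<not> a t) \<or> (\<exists>j<t. a l \<and> \<not> a j))"
          for a :: "nat \<Rightarrow> bool" by (auto simp: less_Suc_eq)
        ultimately show ?case by simp
      qed
      from this[of n] have "generated n g m (\<lambda>a. g a \<and> (\<exists>j<n. a l \<and> \<not> a j))" by simp
      moreover have "(g a \<and> (\<exists>j<n. a l \<and> \<not> a j)) = (g a \<and> a l)" for a
      proof -
        have "\<exists>j<n. \<not> a j" if "g a"
        proof (rule ccontr)
          assume neg: "\<not> (\<exists>j<n. \<not> a j)"
          have "g a = g (\<lambda>_. True)" by (rule depends_belowD[OF n(2)]) (use neg in blast)
          then show False using that g(2) by simp
        qed
        then show ?thesis by blast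
      qed
      ultimately show ?thesis by simp
    qed
    let ?f = "\<lambda>a. beta k (\<lambda>i. a (n + i))"
    have "?f \<in> S"
    proof (rule self_dual_monotone_generated[OF _ _ _ beta_shift[OF k, of n, folded m_def]])
      show "(\<lambda>a. a l) \<in> S" if "l < m" for l
        using proj[OF that] depends_below_proj[OF that] by (simp add: S_def)
      show "(\<lambda>a. maj (p a) (q a) (r a)) \<in> S" if "p \<in> S" "q \<in> S" "r \<in> S" for p q r
      proof -
        have c: "generated n g m (\<lambda>a. g a \<and> (s a \<and> t a))"
          if "generated n g m (\<lambda>a. g a \<and> s a)" "generated n g m (\<lambda>a. g a \<and> t a)" for s t
        proof -
          have "(\<lambda>a. (g a \<and> s a) \<and> (g a \<and> t a)) = (\<lambda>a. g a \<and> (s a \<and> t a))" by auto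
          then show ?thesis using inter[OF that] by simp
        qed
        show ?thesis
          using that depends_below_maj[of m p q r] unfolding S_def maj_def mem_Collect_eq
          by (intro conjI union[OF gm] c) simp_all
      qed
    qed (simp add: S_def)
    then have "generated n g m (\<lambda>a. g a \<and> ?f a)" by (simp add: S_def)
    moreover have "generated n g m (\<lambda>a. g a \<and> a i)" using proj[of i] i by (simp add: m_def)
    ultimately have "generated n g m (\<lambda>a. g a \<and> \<not> ((g a \<and> a i) \<and> \<not> (g a \<and> ?f a)))"
      by (intro minus gm)
    moreover have "(\<lambda>a. g a \<and> \<not> ((g a \<and> a i) \<and> \<not> (g a \<and> ?f a))) = extension n G k"
      by (auto simp: extension_def G_def fun_eq_iff)
    ultimately show ?thesis by (simp add: m_def)
  qed
  ultimately show ?thesis using i unfolding antichain_extendable_def by blast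
qed

text \<open>All generated functions are invariant under complementing all arguments, so neither
  projections nor \<open>beta k\<close> are available. Sums of two variables are, and functions are
  represented by their sum with variable 0. Substituted into \<open>g\<close>, this shift
  complements all arguments or none, and \<open>g\<close> does not see it.\<close>

lemma extendable_reflexive:
  assumes n: "n \<ge> 1" "depends_below n g" and g0: "\<not> g (\<lambda>_. False)"
    and refl: "\<And>a. g (\<lambda>i. \<not> a i) = g a" and nonaffine: "\<not> affine n g"
  shows "antichain_extendable n g"
proof -
  interpret comp_closed "generated n g" by (rule generated_closed[OF n])
  have g1: "\<not> g (\<lambda>_. True)" using refl[of "\<lambda>_. False"] g0 by simp
  obtain a b where ab: "g (\<lambda>i. a i \<noteq> b i) \<noteq> (g a \<noteq> g b)"
    using additive_imp_affine[OF n(2)] nonaffine by blast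
  obtain u where u: "g u" using ab by blast
  have "(\<lambda>x :: nat \<Rightarrow> bool. if x 0 then if x 1 then g (\<lambda>_. True) else g u
      else if x 1 then g (\<lambda>i. \<not> u i) else g (\<lambda>_. False)) = (\<lambda>x. x 0 \<noteq> x 1)"
    using g0 g1 u refl by (simp add: fun_eq_iff)
  then have xorP: "generated n g 2 (\<lambda>x. x 0 \<noteq> x 1)"
    using two_blocks[OF generated.base, of u] by (simp only:)
  note xor = comp2[where F = "(\<noteq>)", OF xorP]
  note xor_var = ident2[where F = "(\<noteq>)", OF xorP]
  have "generated n g 3 (\<lambda>x. (x 1 \<noteq> x 0) \<and> (x 2 \<noteq> x 0))"
  proof -
    \<comment> \<open>With \<open>y\<close>, \<open>z\<close> for the sums of \<open>x 1\<close>,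
      \<open>x 2\<close> with \<open>x 0\<close>, the arguments form the linear combination
      \<open>y a + z b\<close> modulo 2. The defect \<open>ab\<close> makes \<open>g\<close>
      contribute the product of \<open>y\<close> and \<open>z\<close> on top of a linear part, which
      is then subtracted.\<close>
    define r :: "nat \<Rightarrow> bfn" where "r = (\<lambda>i. if a i then if b i then (\<lambda>x. x 1 \<noteq> x 2) else (\<lambda>x. x 1 \<noteq> x 0)
      else if b i then (\<lambda>x. x 2 \<noteq> x 0) else (\<lambda>x. x 0 \<noteq> x 0))"
    have "generated n g 3 (r i)" for i
      unfolding r_def using xor_var[of 1 3 2] xor_var[of 1 3 0] xor_var[of 2 3 0] xor_var[of 0 3 0] by simp
    then have t: "generated n g 3 (\<lambda>x. g (\<lambda>i. r i x))" by (intro compI[OF generated.base])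
    have val: "g (\<lambda>i. r i x) = (((x 1 \<noteq> x 0) \<and> (x 2 \<noteq> x 0)) \<noteq>
        (((x 1 \<noteq> x 0) \<and> g a) \<noteq> ((x 2 \<noteq> x 0) \<and> g b)))" for x
    proof -
      have "(\<lambda>i. r i x) = (if x 1 \<noteq> x 0 then if x 2 \<noteq> x 0 then (\<lambda>i. a i \<noteq> b i) else a
          else if x 2 \<noteq> x 0 then b else (\<lambda>_. False))"
        by (auto simp: r_def fun_eq_iff)
      then show ?thesis using ab g0 by auto
    qed
    have lin: "generated n g 3 (\<lambda>x. (x j \<noteq> x 0) \<and> z)" if "j < 3" for j z
      using xor_var[of j 3 0] xor_var[of 0 3 0] that by (cases z) simp_all
    have "generated n g 3 (\<lambda>x. g (\<lambda>i. r i x) \<noteq> (((x 1 \<noteq> x 0) \<and> g a) \<noteq> ((x 2 \<noteq> x 0) \<and> g b)))"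
      by (rule xor[OF t xor[OF lin lin]]) simp_all
    moreover have "(\<lambda>x. g (\<lambda>i. r i x) \<noteq> (((x 1 \<noteq> x 0) \<and> g a) \<noteq> ((x 2 \<noteq> x 0) \<and> g b))) =
        (\<lambda>x. (x 1 \<noteq> x 0) \<and> (x 2 \<noteq> x 0))"
      unfolding val by (rule ext) argo
    ultimately show ?thesis by simp
  qed
  note mult = comp3[where F = "\<lambda>x y z. (y \<noteq> x) \<and> (z \<noteq> x)", OF this]
  obtain i c where i: "i < n" and c: "g (c(i := False)) \<noteq> g (c(i := True))"
    using sensitive_variable[OF n(2), of u "\<lambda>_. False"] u g0 by blast
  define G where "G a y = g (a(i := y))" for a y
  have "depends_below n (\<lambda>a. G a y)" for y
    unfolding G_def by (rule depends_below_update[OF n(2)]) simp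
  moreover have "G c False \<noteq> G c True" using c by (simp add: G_def)
  moreover have "G a (a i) = g a" for a by (simp add: G_def)
  moreover have "generated n g (n + k + 1) (extension n G k)" if k: "k \<ge> 3" for k
  proof -
    define m where "m = n + k + 1"
    define S where "S = {r. depends_below m r \<and> generated n g m (\<lambda>a. r a \<noteq> a 0)}"
    let ?f = "\<lambda>a. beta k (\<lambda>i. a (n + i))"
    have "?f \<in> S"
    proof (rule self_dual_monotone_generated[OF _ _ _ beta_shift[OF k, of n, folded m_def]])
      show "(\<lambda>a. a l) \<in> S" if "l < m" for l
        using xor_var[of l m 0] that depends_below_proj[OF that] by (simp add: S_def)
      show "(\<lambda>a. maj (p a) (q a) (r a)) \<in> S" if S: "p \<in> S" "q \<in> S" "r \<in> S" for p q r
      proof -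
        let ?x = "\<lambda>p a. p a \<noteq> a 0"
        have x: "generated n g m (?x p)" "generated n g m (?x q)" "generated n g m (?x r)"
          using S by (simp_all add: S_def)
        \<comment> \<open>Modulo 2, majority of \<open>p\<close>, \<open>q\<close>, \<open>r\<close>
          is \<open>(q + p)(r + p) + p\<close>; the shift by \<open>a 0\<close> cancels in the
          product and survives in the last summand.\<close>
        have "generated n g m (\<lambda>a. ((?x q a \<noteq> ?x p a) \<and> (?x r a \<noteq> ?x p a)) \<noteq> ?x p a)"
          by (rule xor[OF mult[OF x] x(1)])
        moreover have "(\<lambda>a. ((?x q a \<noteq> ?x p a) \<and> (?x r a \<noteq> ?x p a)) \<noteq> ?x p a) =
            (\<lambda>a. maj (p a) (q a) (r a) \<noteq> a 0)"
          by (auto simp: maj_def fun_eq_iff)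
        ultimately show ?thesis using S depends_below_maj[of m p q r] by (simp add: S_def)
      qed
    qed (simp add: S_def)
    then have f: "generated n g m (\<lambda>a. ?f a \<noteq> a 0)" by (simp add: S_def)
    define r where "r j = (if j = i then (\<lambda>a. ?f a \<noteq> a 0) else (\<lambda>a. a j \<noteq> a 0))" for j
    have "generated n g m (r j)" if "j < n" for j
      using f xor_var[of j m 0] that by (simp add: r_def m_def)
    then have "generated n g m (\<lambda>a. g (\<lambda>j. r j a))" by (rule compI[OF generated.base])
    moreover have "g (\<lambda>j. r j a) = g (a(i := ?f a))" for a
    proof (cases "a 0")
      case True
      then have "(\<lambda>j. r j a) = (\<lambda>j. \<not> (a(i := ?f a)) j)" by (auto simp: r_def fun_eq_iff)
      then show ?thesis using refl[of "a(i := ?f a)"] by simp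
    next
      case False
      then have "(\<lambda>j. r j a) = a(i := ?f a)" by (auto simp: r_def fun_eq_iff)
      then show ?thesis by simp
    qed
    ultimately show ?thesis by (simp add: extension_def G_def m_def)
  qed
  ultimately show ?thesis using i unfolding antichain_extendable_def by blast
qed

lemma extendable_of_not_simple:
  assumes n: "n \<ge> 1" "depends_below n g" and nonsimple: "\<not> simple n g"
  shows "antichain_extendable n g"
proof -
  have zero: "antichain_extendable n h"
    if h: "depends_below n h" "\<not> h (\<lambda>_. False)" "\<not> h (\<lambda>_. True)" "\<not> simple n h" for h
  proof (cases "\<exists>u. h u \<and> \<not> h (\<lambda>i. \<not> u i)")
    case True
    then show ?thesis using extendable_difference[OF n(1) h(1-3)] by blast
  next
    case False
    then have "h (\<lambda>i. \<not> a i) = h a" for a using False[simplified, rule_format, of a]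
        False[simplified, rule_format, of "\<lambda>i. \<not> a i"] by auto
    then show ?thesis by (rule extendable_reflexive[OF n(1) h(1,2)]) (use h(4) in \<open>simp add: simple_def\<close>)
  qed
  consider "\<not> g (\<lambda>_. False)" "\<not> g (\<lambda>_. True)" | "\<not> g (\<lambda>_. False)" "g (\<lambda>_. True)"
    | "g (\<lambda>_. False)" "\<not> g (\<lambda>_. True)" | "g (\<lambda>_. False)" "g (\<lambda>_. True)" by blast
  then show ?thesis
  proof cases
    case 1
    then show ?thesis using zero[OF n(2)] nonsimple by blast
  next
    case 2
    then show ?thesis using extendable_idempotent[OF n] nonsimple by blast
  next
    case 3
    then show ?thesis using extendable_negation[OF n] nonsimple by blast
  next
    case 4
    have "\<not> simple n (dual_fn g)" using simple_dual[of n g] nonsimple by (auto simp: dual_fn_def)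
    then have "antichain_extendable n (dual_fn g)"
      by (intro zero depends_below_dual_fn n(2)) (use 4 in \<open>simp_all add: dual_fn_def\<close>)
    then show ?thesis by (rule extendable_dual)
  qed
qed

section \<open>Uncountable intervals\<close>

lemma uncountable_nat_sets: "uncountable (UNIV :: nat set set)"
proof
  assume "countable (UNIV :: nat set set)"
  then have "range (from_nat_into (UNIV :: nat set set)) = Pow UNIV"
    by (simp add: range_from_nat_into)
  then show False using Cantors_theorem[of "UNIV :: nat set"] by blast
qed

lemma uncountable_interval:
  fixes F :: "nat \<Rightarrow> bfun"
  assumes C: "equational_class C1" "equational_class C2" "C1 \<subseteq> C2"
    and F: "\<And>t. F t \<in> C2" "\<And>t. F t \<notin> C1" and anti: "\<And>s t. F s \<preceq>\<^sub>V F t \<Longrightarrow> s = t"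
  shows "uncountable (class_interval C1 C2)"
proof
  assume count: "countable (class_interval C1 C2)"
  define K where "K T = C1 \<union> {H\<in>bool_functions. \<exists>t\<in>T. H \<preceq>\<^sub>V F t}" for T
  have sub: "C1 \<subseteq> bool_functions" "C2 \<subseteq> bool_functions"
    using C by (auto simp: equational_class_def)
  have Ff: "F t \<in> bool_functions" for t using F(1) sub(2) by blast
  have "K T \<in> class_interval C1 C2" for T
  proof -
    have "equational_class (K T)"
      unfolding equational_class_def
    proof (intro conjI ballI impI)
      show "K T \<subseteq> bool_functions" using sub(1) by (auto simp: K_def)
      fix H G assume H: "H \<in> K T" and G: "G \<in> bool_functions" "G \<preceq>\<^sub>V H"
      show "G \<in> K T"
      proof (cases "H \<in> C1")
        case True
        then show ?thesis using G C(1) by (auto simp: K_def equational_class_def)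
      next
        case False
        then obtain t where "t \<in> T" "H \<in> bool_functions" "H \<preceq>\<^sub>V F t" using H by (auto simp: K_def)
        then show ?thesis using minor_trans[OF G(1) _ Ff G(2)] G(1) by (auto simp: K_def)
      qed
    qed
    moreover have "K T \<subseteq> C2"
      using C(2,3) F(1) unfolding K_def equational_class_def by blast
    ultimately show ?thesis by (simp add: class_interval_def K_def)
  qed
  then have "countable (range K)" using count by (auto intro: countable_subset)
  moreover have "inj K"
  proof (rule injI)
    have mem: "F t \<in> K T \<longleftrightarrow> t \<in> T" for t T
      using F(2)[of t] anti[of t] minor_refl[OF Ff] Ff by (auto simp: K_def)
    fix T T' assume "K T = K T'"
    then show "T = T'" using mem by blast
  qed
  ultimately have "countable (UNIV :: nat set set)" by (rule countable_image_inj_on)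
  then show False using uncountable_nat_sets by blast
qed

theorem theorem9:
  fixes C1 C2 :: "bfun set"
  assumes "equational_class C1" and "equational_class C2"
    and "idempotent_class C1" and "idempotent_class C2"
    and "C1 \<subseteq> C2"
  shows "uncountable (class_interval C1 C2) \<longleftrightarrow> (\<exists>G \<in> C2 - C1. non_associative G)"
proof
  assume "uncountable (class_interval C1 C2)"
  then show "\<exists>G \<in> C2 - C1. non_associative G"
    using countable_interval_quasi_associative[OF assms(2), of C1] unfolding non_associative_def by blast
next
  assume "\<exists>G \<in> C2 - C1. non_associative G"
  then obtain H where H: "H \<in> C2" "H \<notin> C1" "non_associative H" by blast
  then have "H \<in> bool_functions" using assms(2) by (auto simp: equational_class_def)
  then obtain n g where g: "n \<ge> 1" "depends_below n g" "H = emb n g"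
    by (elim bool_functions_emb)
  have "\<not> simple n g"
    using H(3) quasi_associative_iff[OF g(1,2)] by (simp add: non_associative_def g(3))
  then have "antichain_extendable n g" by (rule extendable_of_not_simple[OF g(1,2)])
  then obtain G i d where G: "i < n" "\<And>y. depends_below n (\<lambda>a. G a y)" "G d False \<noteq> G d True"
    "\<And>a. G a (a i) = g a"
    "\<And>k. k \<ge> 3 \<Longrightarrow> generated n g (n + k + 1) (extension n G k)"
    unfolding antichain_extendable_def by blast
  \<comment> \<open>The offset is the bound required by
    \<open>extension_minor_unique\<close>.\<close>
  define k where "k t = n + 7 + t" for t :: nat
  define F where "F t = emb (n + k t + 1) (extension n G (k t))" for t
  have k3: "k t \<ge> 3" for t by (simp add: k_def)
  have dep_ext: "depends_below (n + k t + 1) (extension n G (k t))" for t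
    by (rule depends_below_extension[OF G(2)])
  show "uncountable (class_interval C1 C2)"
  proof (rule uncountable_interval[OF assms(1,2,5)])
    have "class_comp C2 C2 \<subseteq> C2" using assms(4) by (simp add: idempotent_class_def)
    then interpret comp_closed "\<lambda>m p. depends_below m p \<and> emb m p \<in> C2"
      by (rule comp_closed_class[OF assms(2)])
    show C2: "F t \<in> C2" for t
      using generated_le[OF _ G(5)[OF k3]] g H(1) by (simp add: F_def)
    show "F t \<notin> C1" for t
    proof
      assume "F t \<in> C1"
      moreover have "H \<preceq>\<^sub>V F t"
        unfolding g(3) F_def
      \<comment> \<open>All new variables are identified with \<open>a i\<close>;
        \<open>beta\<close> then returns \<open>a i\<close> by \<open>beta_const\<close>.\<close>
      proof (rule emb_minorI[OF dep_ext, where \<sigma> = "\<lambda>j. if j < n then j else i"])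
        show "(if j < n then j else i) < n" for j using G(1) by simp
        have "g a = extension n G (k t) (\<lambda>j. a (if j < n then j else i))" for a
        proof -
          have "extension n G (k t) (\<lambda>j. a (if j < n then j else i)) =
              G (\<lambda>j. a (if j < n then j else i)) (a i)"
            by (simp add: extension_def beta_const[OF k3])
          also have "\<dots> = G a (a i)" by (rule depends_belowD[OF G(2)]) simp
          finally show ?thesis by (simp add: G(4))
        qed
        then show "g = (\<lambda>a. extension n G (k t) (\<lambda>j. a (if j < n then j else i)))" by (rule ext)
      qed
      ultimately have "H \<in> C1"
        using assms(1) \<open>H \<in> bool_functions\<close> unfolding equational_class_def by blast
      with H(2) show False ..
    qed
    show "s = t" if st: "F s \<preceq>\<^sub>V F t" for s t
    proof -
      obtain \<sigma> where "\<And>j. j < n + k t + 1 \<Longrightarrow> \<sigma> j < n + k s + 1"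
        "extension n G (k s) = (\<lambda>a. extension n G (k t) (\<lambda>j. a (\<sigma> j)))"
        using emb_minorD[OF dep_ext dep_ext st[unfolded F_def]] by blast
      from extension_minor_unique[OF G(2,3) _ _ this] have "k s = k t" by (simp add: k_def)
      then show ?thesis by (simp add: k_def)
    qed
  qed
qed

end
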